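(* Let $m\ge1$, $N=2^m$. (a) The symplectic group $\mathrm{Sp}(2m,\mathbb{F}_2)$ acts transitively on vertices, on edges, and on non-edges of the Heisenberg-Weyl graph $\mathbb{H}_N$. (b) The groups $\mathfrak{P}_{\mathrm{K},m}$ and $\mathfrak{P}_{\mathrm{K},m}^*$ act transitively on vertices of $\mathbb{H}_N$.
   Context: The Heisenberg-Weyl graph $\mathbb{H}_N$ has $N^2-1$ vertices, labeled by the pairs $\pm E(a,b)$ of Hermitian Pauli matrices with $[a,b]\in\mathbb{F}_2^{2m}$, $[a,b]\neq[0,0]$; the vertex $\pm E(a,b)$ is denoted $[a,b]$. Two distinct vertices $[a,b]$ and $[c,d]$ are joined iff $E(a,b)$ and $E(c,d)$ commute, equivalently $ad^T+bc^T=0$ in $\mathbb{F}_2$. (Here $E(a,b)=\imath^{ab^T}X^{a_1}Z^{b_1}\otimes\cdots\otimes X^{a_m}Z^{b_m}$ with $X,Z$ the Pauli matrices.) A non-edge is a pair of distinct vertices that are not joined. $\mathrm{Sp}(2m,\mathbb{F}_2)$ is the group of $2m\times 2m$ binary matrices $F$ with $F\Omega F^T=\Omega$, $\Omega=\begin{bmatrix} 0 & I_m \\ I_m & 0 \end{bmatrix}$, acting on vertices by $[a,b]\mapsto[a,b]F$. Field setup: $\mathbb{F}_{2^m}$ is obtained from $\mathbb{F}_2$ by adjoining a root $\alpha$ of a primitive irreducible polynomial of degree $m$; elements are identified with row vectors in $\mathbb{F}_2^m$ via the basis $1,\alpha,\ldots,\alpha^{m-1}$. $W$ is the invertible binary symmetric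 matrix with $\mathrm{Tr}(xy)=xWy^T$; $A_z$ is defined by $xA_z=xz$; $R$ is the binary matrix of the Frobenius map: $xR=x^2$. $L_Q=\begin{bmatrix} Q & 0 \\ 0 & Q^{-T} \end{bmatrix}$ for $Q$ invertible ($Q^{-T}=(Q^{-1})^T$); $T_P=\begin{bmatrix} I_m & P \\ 0 & I_m \end{bmatrix}$ for $P=P^T$. $\mathfrak{P}_{\mathrm{K},m}\subseteq\mathrm{Sp}(2m,\mathbb{F}_2)$ is the group generated by $T_{A_x^2W}$ ($x\in\mathbb{F}_{2^m}$), $L_{A_x^{-1}}$ ($x\in\mathbb{F}_{2^m}\setminus\{0\}$) and $\Omega L_{W^{-1}}$. $\mathfrak{P}_{\mathrm{K},m}^*$ is the group generated by $T_{A_x^2W}$ ($x\in\mathbb{F}_{2^m}$), $L_{R^{-i}A_x^{-1}}$ ($x\in\mathbb{F}_{2^m}\setminus\{0\}$, $i\in\{0,\ldots,m-1\}$) and $\Omega L_{W^{-1}}$. *)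

theory Defs
  imports
    "HOL-Library.Z2"
    "HOL-Computational_Algebra.Polynomial_Factorial"
    "HOL-Algebra.Generated_Groups"
    "HOL-Algebra.Group_Action"
    "Jordan_Normal_Form.Gauss_Jordan_Elimination"
    "Jordan_Normal_Form.Determinant"
begin

section \<open>Right actions\<close>

text \<open>
  Binary vectors are row vectors, so matrices act from the right. \<open>transitive_action\<close> is about
  left actions; a right action of \<open>G\<close> is the same thing as a left action of the opposite group.
  For \<open>S = {}\<close> the notion is vacuously true.
\<close>

definition opposite :: "('a, 'b) monoid_scheme \<Rightarrow> 'a monoid" where
  "opposite G = \<lparr>carrier = carrier G, monoid.mult = (\<lambda>x y. y \<otimes>\<^bsub>G\<^esub> x), one = \<one>\<^bsub>G\<^esub>\<rparr>"

definition transitive_right_action ::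
    "('a, 'b) monoid_scheme \<Rightarrow> 'c set \<Rightarrow> ('c \<Rightarrow> 'a \<Rightarrow> 'c) \<Rightarrow> bool" where
  "transitive_right_action G S act \<longleftrightarrow>
     transitive_action (opposite G) S (\<lambda>g. \<lambda>x\<in>S. act x g)"

definition row_mult :: "'a :: comm_semiring_0 vec \<Rightarrow> 'a mat \<Rightarrow> 'a vec"  (infixl "\<^sub>v*" 70) where
  "v \<^sub>v* F = transpose_mat F *\<^sub>v v"

text \<open>The induced action on sets of vertices (used for edges and non-edges).\<close>

definition row_mult_set :: "'a :: comm_semiring_0 vec set \<Rightarrow> 'a mat \<Rightarrow> 'a vec set" where
  "row_mult_set e F = (\<lambda>v. v \<^sub>v* F) ` e"


section \<open>The symplectic group\<close>

abbreviation inv_mat :: "'a :: field mat \<Rightarrow> 'a mat" where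
  "inv_mat A \<equiv> the (mat_inverse A)"

definition Omega :: "nat \<Rightarrow> bit mat" where
  "Omega m = four_block_mat (0\<^sub>m m m) (1\<^sub>m m) (1\<^sub>m m) (0\<^sub>m m m)"

definition Sp :: "nat \<Rightarrow> bit mat monoid" where
  "Sp m = \<lparr>carrier = {F \<in> carrier_mat (2 * m) (2 * m). F * Omega m * transpose_mat F = Omega m},
           monoid.mult = (*), one = 1\<^sub>m (2 * m)\<rparr>"

lemma Omega_carrier [simp]: "Omega m \<in> carrier_mat (2 * m) (2 * m)"
  unfolding Omega_def mult_2 by (rule four_block_carrier_mat) auto

lemma Omega_Omega: "Omega m * Omega m = 1\<^sub>m (2 * m)"
  unfolding Omega_def mult_2
  by (subst mult_four_block_mat[of _ m m _ m _ m _ _ m _ m]) auto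

lemma group_Sp: "group (Sp m)"
proof -
  let ?M = "carrier_mat (2 * m) (2 * m) :: bit mat set"
  have mult: "A * B \<in> ?M" if "A \<in> ?M" "B \<in> ?M" for A B
    using that by (rule mult_carrier_mat)
  note ones = left_mult_one_mat[of _ "2 * m" "2 * m"] right_mult_one_mat[of _ "2 * m" "2 * m"]
  note assoc = assoc_mult_mat[of _ "2 * m" "2 * m" _ "2 * m" _ "2 * m"]
  show ?thesis
  proof (rule groupI)
    fix F G assume FG: "F \<in> carrier (Sp m)" "G \<in> carrier (Sp m)"
    then have c: "F \<in> carrier_mat (2 * m) (2 * m)" "G \<in> carrier_mat (2 * m) (2 * m)"
      by (auto simp: Sp_def)
    have "F * G * Omega m * transpose_mat (F * G) = F * (G * Omega m * transpose_mat G) * transpose_mat F"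
      using c by (simp add: transpose_mult[OF c] mult assoc)
    also have "G * Omega m * transpose_mat G = Omega m"
      using FG by (simp add: Sp_def)
    also have "F * Omega m * transpose_mat F = Omega m"
      using FG by (simp add: Sp_def)
    finally show "F \<otimes>\<^bsub>Sp m\<^esub> G \<in> carrier (Sp m)"
      using mult[OF c] unfolding Sp_def by simp
  next
    fix F assume F: "F \<in> carrier (Sp m)"
    then have c: "F \<in> carrier_mat (2 * m) (2 * m)" and eq: "F * Omega m * transpose_mat F = Omega m"
      by (auto simp: Sp_def)
    define G where "G = Omega m * transpose_mat F * Omega m"
    have Gc: "G \<in> carrier_mat (2 * m) (2 * m)" using c by (simp add: G_def mult)
    have "F * G = (F * Omega m * transpose_mat F) * Omega m"
      using c by (simp add: G_def mult assoc)
    then have "F * G = 1\<^sub>m (2 * m)" by (simp add: eq Omega_Omega)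
    then have GF: "G * F = 1\<^sub>m (2 * m)" by (rule mat_mult_left_right_inverse[OF c Gc])
    have "G * Omega m * transpose_mat G = G * (F * Omega m * transpose_mat F) * transpose_mat G"
      by (simp add: eq)
    also have "\<dots> = (G * F) * Omega m * transpose_mat (G * F)"
      using c Gc by (simp add: transpose_mult[OF Gc c] mult assoc)
    finally have "G \<in> carrier (Sp m)" using Gc by (simp add: GF Sp_def ones)
    with GF show "\<exists>G\<in>carrier (Sp m). G \<otimes>\<^bsub>Sp m\<^esub> F = \<one>\<^bsub>Sp m\<^esub>"
      by (auto simp: Sp_def)
  qed (auto simp: Sp_def mult assoc ones)
qed

definition L_mat :: "bit mat \<Rightarrow> bit mat" where
  "L_mat Q = four_block_mat Q (0\<^sub>m (dim_row Q) (dim_col Q))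
                              (0\<^sub>m (dim_row Q) (dim_col Q)) (transpose_mat (inv_mat Q))"

definition T_mat :: "bit mat \<Rightarrow> bit mat" where
  "T_mat P = four_block_mat (1\<^sub>m (dim_row P)) P (0\<^sub>m (dim_row P) (dim_row P)) (1\<^sub>m (dim_row P))"


section \<open>Hermitian Pauli matrices and the Heisenberg-Weyl graph\<close>

definition kron :: "'a :: semiring_0 mat \<Rightarrow> 'a mat \<Rightarrow> 'a mat" where
  "kron A B = mat (dim_row A * dim_row B) (dim_col A * dim_col B)
     (\<lambda>(i, j). A $$ (i div dim_row B, j div dim_col B) * B $$ (i mod dim_row B, j mod dim_col B))"

definition pauli_X :: "complex mat" where
  "pauli_X = mat_of_rows_list 2 [[0, 1], [1, 0]]"

definition pauli_Z :: "complex mat" where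
  "pauli_Z = mat_of_rows_list 2 [[1, 0], [0, -1]]"

text \<open>
  The exponent \<open>a b\<^sup>T\<close> of \<open>\<i>\<close> is an integer (only its residue modulo 4 matters), not an element
  of the field with two elements; this is what makes \<open>E(a, b)\<close> Hermitian.
  The empty Kronecker product is the 1-by-1 identity.
\<close>

definition pauli_E :: "nat \<Rightarrow> bit vec \<Rightarrow> bit vec \<Rightarrow> complex mat" where
  "pauli_E m a b =
     \<i> ^ (\<Sum>k<m. of_bit (a $ k) * of_bit (b $ k)) \<cdot>\<^sub>m
       foldr kron (map (\<lambda>k. pauli_X ^\<^sub>m of_bit (a $ k) * pauli_Z ^\<^sub>m of_bit (b $ k)) [0..<m])
                  (1\<^sub>m 1)"

text \<open>The vertex \<open>[a, b]\<close>, i.e. the pair \<open>\<plusminus>E(a, b)\<close>, is represented by its label \<open>a @\<^sub>v b\<close>.\<close>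

definition hw_vertices :: "nat \<Rightarrow> bit vec set" where
  "hw_vertices m = carrier_vec (2 * m) - {0\<^sub>v (2 * m)}"

definition hw_commute :: "nat \<Rightarrow> bit vec \<Rightarrow> bit vec \<Rightarrow> bool" where
  "hw_commute m u v \<longleftrightarrow>
     (let E = (\<lambda>w. pauli_E m (vec_first w m) (vec_last w m)) in E u * E v = E v * E u)"

definition hw_edges :: "nat \<Rightarrow> bit vec set set" where
  "hw_edges m = {{u, v} | u v. u \<in> hw_vertices m \<and> v \<in> hw_vertices m \<and> u \<noteq> v \<and> hw_commute m u v}"

definition hw_nonedges :: "nat \<Rightarrow> bit vec set set" where
  "hw_nonedges m =
     {{u, v} | u v. u \<in> hw_vertices m \<and> v \<in> hw_vertices m \<and> u \<noteq> v \<and> \<not> hw_commute m u v}"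


section \<open>The field with \<open>2\<^sup>m\<close> elements\<close>

text \<open>
  The field is the ring of binary polynomials modulo \<open>p\<close>, where \<open>m = degree p\<close>, and the adjoined
  root \<open>\<alpha>\<close> is the residue class of the indeterminate \<open>[:0, 1:]\<close>.
  Primitivity means that \<open>\<alpha>\<close> is nonzero and generates the multiplicative group of the field.
\<close>

definition primitive_poly :: "bit poly \<Rightarrow> bool" where
  "primitive_poly p \<longleftrightarrow> irreducible p \<and> \<not> p dvd [:0, 1:] \<and>
     (\<forall>f. \<not> p dvd f \<longrightarrow> (\<exists>k. f mod p = [:0, 1:] ^ k mod p))"

text \<open>
  Field elements are row vectors of length \<open>m\<close>: the vector \<open>x\<close> stands for
  \<open>x\<^sub>0 + x\<^sub>1 \<alpha> + \<dots> + x\<^sub>m\<^sub>-\<^sub>1 \<alpha>\<^sup>m\<^sup>-\<^sup>1\<close>. Addition is vector addition.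
\<close>

definition poly_of :: "bit vec \<Rightarrow> bit poly" where
  "poly_of x = Poly (list_of_vec x)"

definition fld_of :: "bit poly \<Rightarrow> bit poly \<Rightarrow> bit vec" where
  "fld_of p f = vec (degree p) (coeff (f mod p))"

definition fld_mult :: "bit poly \<Rightarrow> bit vec \<Rightarrow> bit vec \<Rightarrow> bit vec" where
  "fld_mult p x y = fld_of p (poly_of x * poly_of y)"

text \<open>
  \<open>x + x\<^sup>2 + x\<^sup>4 + \<dots>\<close> (\<open>m\<close> summands) lies in the prime field, so its residue is a constant
  polynomial; see \<open>trace_const\<close> below.
\<close>

definition fld_trace :: "bit poly \<Rightarrow> bit vec \<Rightarrow> bit" where
  "fld_trace p x = coeff ((\<Sum>i<degree p. poly_of x ^ (2 ^ i)) mod p) 0"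

text \<open>
  The three matrices are given by their defining properties; \<open>A_mat\<close>, \<open>R_mat\<close> and \<open>W_mat\<close> below
  show that these have unique solutions.
\<close>

definition A_mat :: "bit poly \<Rightarrow> bit vec \<Rightarrow> bit mat" where
  "A_mat p z = (THE A. A \<in> carrier_mat (degree p) (degree p) \<and>
     (\<forall>x\<in>carrier_vec (degree p). x \<^sub>v* A = fld_mult p x z))"

definition R_mat :: "bit poly \<Rightarrow> bit mat" where
  "R_mat p = (THE A. A \<in> carrier_mat (degree p) (degree p) \<and>
     (\<forall>x\<in>carrier_vec (degree p). x \<^sub>v* A = fld_mult p x x))"

definition W_mat :: "bit poly \<Rightarrow> bit mat" where
  "W_mat p = (THE A. A \<in> carrier_mat (degree p) (degree p) \<and>
     (\<forall>x\<in>carrier_vec (degree p). \<forall>y\<in>carrier_vec (degree p).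
        fld_trace p (fld_mult p x y) = (x \<^sub>v* A) \<bullet> y))"


lemma additive_functional:
  fixes g :: "bit vec \<Rightarrow> bit"
  assumes add: "\<And>x y. x \<in> carrier_vec n \<Longrightarrow> y \<in> carrier_vec n \<Longrightarrow> g (x + y) = g x + g y"
    and x: "x \<in> carrier_vec n"
  shows "g x = (\<Sum>i<n. x $ i * g (unit_vec n i))"
proof -
  have g0: "g (0\<^sub>v n) = 0"
    using add[of "0\<^sub>v n" "0\<^sub>v n"] by simp
  have "g (vec n (\<lambda>i. if i < k then x $ i else 0)) = (\<Sum>i<k. x $ i * g (unit_vec n i))"
    if "k \<le> n" for k
    using that
  proof (induction k)
    case 0
    have "vec n (\<lambda>i. if i < 0 then x $ i else 0) = 0\<^sub>v n" by (intro eq_vecI) auto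
    then show ?case using g0 by simp
  next
    case (Suc k)
    let ?v = "\<lambda>k. vec n (\<lambda>i. if i < k then x $ i else 0)"
    have "?v (Suc k) = ?v k + x $ k \<cdot>\<^sub>v unit_vec n k"
      using Suc.prems by (intro eq_vecI) (auto simp: less_Suc_eq)
    then have "g (?v (Suc k)) = g (?v k) + g (x $ k \<cdot>\<^sub>v unit_vec n k)"
      by (simp add: add)
    also have "g (x $ k \<cdot>\<^sub>v unit_vec n k) = x $ k * g (unit_vec n k)"
    proof (cases "x $ k")
      case zero
      have "0 \<cdot>\<^sub>v unit_vec n k = (0\<^sub>v n :: bit vec)" by (intro eq_vecI) auto
      with zero g0 show ?thesis by simp
    qed auto
    finally show ?case using Suc by simp
  qed
  from this[of n] have "g (vec n (\<lambda>i. if i < n then x $ i else 0)) = (\<Sum>i<n. x $ i * g (unit_vec n i))"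
    by simp
  moreover have "vec n (\<lambda>i. if i < n then x $ i else 0) = x"
    using x by (intro eq_vecI) auto
  ultimately show ?thesis by simp
qed

lemma row_mult_index:
  assumes "A \<in> carrier_mat n k" "x \<in> carrier_vec n" "j < k"
  shows "(x \<^sub>v* A) $ j = (\<Sum>i<n. x $ i * A $$ (i, j))"
  using assms by (auto simp: row_mult_def scalar_prod_def mult.commute atLeast0LessThan intro!: sum.cong)

lemma row_mult_carrier [simp]:
  "A \<in> carrier_mat n k \<Longrightarrow> x \<^sub>v* A \<in> carrier_vec k"
  by (auto simp: row_mult_def intro!: carrier_vecI)

lemma row_mult_unit:
  fixes A :: "bit mat"
  assumes "A \<in> carrier_mat n k" "i < n" "j < k"
  shows "(unit_vec n i \<^sub>v* A) $ j = A $$ (i, j)"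
proof -
  have "(unit_vec n i \<^sub>v* A) $ j = (\<Sum>l<n. unit_vec n i $ l * A $$ (l, j))"
    using assms by (intro row_mult_index) auto
  also have "\<dots> = (\<Sum>l<n. if l = i then A $$ (l, j) else 0)"
    by (rule sum.cong) (use assms in auto)
  also have "\<dots> = A $$ (i, j)"
    using assms by (subst sum.delta) auto
  finally show ?thesis .
qed

lemma additive_map_ex1:
  fixes f :: "bit vec \<Rightarrow> bit vec"
  assumes add: "\<And>x y. x \<in> carrier_vec n \<Longrightarrow> y \<in> carrier_vec n \<Longrightarrow> f (x + y) = f x + f y"
    and f: "\<And>x. x \<in> carrier_vec n \<Longrightarrow> f x \<in> carrier_vec k"
  shows "\<exists>!A. A \<in> carrier_mat n k \<and> (\<forall>x\<in>carrier_vec n. x \<^sub>v* A = f x)"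
proof (rule ex1I[of _ "mat n k (\<lambda>(i, j). f (unit_vec n i) $ j)"], safe)
  let ?A = "mat n k (\<lambda>(i, j). f (unit_vec n i) $ j)"
  show "?A \<in> carrier_mat n k" by simp
  fix x :: "bit vec" assume x: "x \<in> carrier_vec n"
  show "x \<^sub>v* ?A = f x"
  proof (intro eq_vecI)
    fix j assume "j < dim_vec (f x)"
    then have j: "j < k" using f[OF x] by auto
    have "f x $ j = (\<Sum>i<n. x $ i * f (unit_vec n i) $ j)"
    proof (rule additive_functional[OF _ x])
      fix y z :: "bit vec" assume yz: "y \<in> carrier_vec n" "z \<in> carrier_vec n"
      show "f (y + z) $ j = f y $ j + f z $ j"
        using add[OF yz] f[OF yz(1)] f[OF yz(2)] j by simp
    qed
    then show "(x \<^sub>v* ?A) $ j = f x $ j"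
      using x j by (subst row_mult_index[of _ n k]) auto
  qed (use f[OF x] in \<open>auto simp: row_mult_def\<close>)
next
  fix A assume A: "A \<in> carrier_mat n k" "\<forall>x\<in>carrier_vec n. x \<^sub>v* A = f x"
  show "A = mat n k (\<lambda>(i, j). f (unit_vec n i) $ j)"
    by (intro eq_matI) (use A row_mult_unit[OF A(1)] in auto)
qed

lemma fld_of_carrier [simp]: "fld_of p f \<in> carrier_vec (degree p)"
  by (simp add: fld_of_def)

lemma fld_of_add: "fld_of p (f + g) = fld_of p f + fld_of p g"
  unfolding fld_of_def by (intro eq_vecI) (auto simp: poly_mod_add_left)

lemma coeff_poly_of: "coeff (poly_of x) i = (if i < dim_vec x then x $ i else 0)"
  unfolding poly_of_def coeff_Poly_eq nth_default_def by (simp add: list_of_vec_index)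

lemma poly_of_add:
  "x \<in> carrier_vec n \<Longrightarrow> y \<in> carrier_vec n \<Longrightarrow> poly_of (x + y) = poly_of x + poly_of y"
  by (intro poly_eqI) (auto simp: coeff_poly_of)

lemma poly_of_fld_of: 
  assumes "degree p > 0"
  shows "poly_of (fld_of p f) = f mod p"
proof (intro poly_eqI)
  fix i
  have "degree (f mod p) < degree p"
    using assms degree_mod_less'[of p f] by (cases "f mod p = 0"; cases "p = 0") auto
  then show "coeff (poly_of (fld_of p f)) i = coeff (f mod p) i"
    by (auto simp: coeff_poly_of fld_of_def not_less coeff_eq_0)
qed

lemma fld_mult_add:
  assumes "x \<in> carrier_vec n" "y \<in> carrier_vec n"
  shows "fld_mult p (x + y) z = fld_mult p x z + fld_mult p y z"
    and "fld_mult p z (x + y) = fld_mult p z x + fld_mult p z y"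
  using assms by (simp_all add: fld_mult_def poly_of_add distrib_left distrib_right fld_of_add)

lemma bit_poly_double: "f + f = (0 :: bit poly)"
proof (rule poly_eqI)
  fix n
  have "b + b = 0" for b :: bit by (cases b) simp_all
  then show "coeff (f + f) n = coeff 0 n" by (simp only: coeff_add coeff_0)
qed

lemma fld_square_add:
  assumes "x \<in> carrier_vec n" "y \<in> carrier_vec n"
  shows "fld_mult p (x + y) (x + y) = fld_mult p x x + fld_mult p y y"
proof -
  have "poly_of (x + y) * poly_of (x + y) = poly_of x * poly_of x + poly_of y * poly_of y
      + (poly_of x * poly_of y + poly_of x * poly_of y)"
    using assms by (simp add: poly_of_add algebra_simps)
  then show ?thesis by (simp add: fld_mult_def fld_of_add bit_poly_double)
qed

lemma fld_mult_carrier [simp]: "fld_mult p x y \<in> carrier_vec (degree p)"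
  by (simp add: fld_mult_def)

lemma A_mat:
  shows "A_mat p z \<in> carrier_mat (degree p) (degree p)"
    and "x \<in> carrier_vec (degree p) \<Longrightarrow> x \<^sub>v* A_mat p z = fld_mult p x z"
  using theI'[OF additive_map_ex1[of "degree p" "\<lambda>x. fld_mult p x z" "degree p"]]
  unfolding A_mat_def by (auto simp: fld_mult_add)

lemma R_mat:
  shows "R_mat p \<in> carrier_mat (degree p) (degree p)"
    and "x \<in> carrier_vec (degree p) \<Longrightarrow> x \<^sub>v* R_mat p = fld_mult p x x"
  using theI'[OF additive_map_ex1[of "degree p" "\<lambda>x. fld_mult p x x" "degree p"]]
  unfolding R_mat_def by (auto simp: fld_square_add)

lemma bit_poly_square_add: "(f + g)\<^sup>2 = f\<^sup>2 + (g\<^sup>2 :: bit poly)"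
proof -
  have "(f + g)\<^sup>2 = f\<^sup>2 + g\<^sup>2 + (f * g + f * g)"
    by (simp add: power2_eq_square algebra_simps)
  then show ?thesis by (simp only: bit_poly_double add_0_right)
qed

lemma bit_poly_pow_add: "(f + g) ^ (2 ^ i) = f ^ (2 ^ i) + (g ^ (2 ^ i) :: bit poly)"
  by (induction i) (simp_all add: power_mult mult.commute[of 2] bit_poly_square_add)

lemma fld_trace_add:
  assumes "x \<in> carrier_vec n" "y \<in> carrier_vec n"
  shows "fld_trace p (x + y) = fld_trace p x + fld_trace p y"
  using assms by (simp add: fld_trace_def poly_of_add bit_poly_pow_add sum.distrib poly_mod_add_left)

lemma W_mat_ex1:
  "\<exists>!A. A \<in> carrier_mat (degree p) (degree p) \<and>
     (\<forall>x\<in>carrier_vec (degree p). \<forall>y\<in>carrier_vec (degree p).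
        fld_trace p (fld_mult p x y) = (x \<^sub>v* A) \<bullet> y)"
proof -
  let ?n = "degree p"
  let ?B = "\<lambda>x y. fld_trace p (fld_mult p x y)"
  define f where "f x = vec ?n (\<lambda>j. ?B x (unit_vec ?n j))" for x
  have add: "?B (x + y) z = ?B x z + ?B y z" "?B z (x + y) = ?B z x + ?B z y"
    if "x \<in> carrier_vec ?n" "y \<in> carrier_vec ?n" for x y z
    using that by (simp_all add: fld_mult_add[of _ ?n] fld_trace_add[of _ ?n])
  have B: "?B x y = f x \<bullet> y" if y: "y \<in> carrier_vec ?n" for x y
  proof -
    have "?B x y = (\<Sum>i<?n. y $ i * ?B x (unit_vec ?n i))"
      by (rule additive_functional[OF add(2) y])
    also have "\<dots> = f x \<bullet> y"
      using y unfolding scalar_prod_def atLeast0LessThan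
      by (intro sum.cong) (auto simp: f_def mult.commute)
    finally show ?thesis .
  qed
  have f: "f x \<in> carrier_vec ?n" for x by (simp add: f_def)
  have "(\<forall>y\<in>carrier_vec ?n. ?B x y = (x \<^sub>v* A) \<bullet> y) \<longleftrightarrow> x \<^sub>v* A = f x"
    if A: "A \<in> carrier_mat ?n ?n" for A x
  proof
    assume *: "\<forall>y\<in>carrier_vec ?n. ?B x y = (x \<^sub>v* A) \<bullet> y"
    show "x \<^sub>v* A = f x"
    proof (rule eq_vecI)
      fix i assume "i < dim_vec (f x)"
      then have i: "i < ?n" by (simp add: f_def)
      show "(x \<^sub>v* A) $ i = f x $ i"
        using *[rule_format, of "unit_vec ?n i"] i row_mult_carrier[OF A, of x]
        by (simp add: f_def scalar_prod_right_unit)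
    qed (use A in \<open>auto simp: f_def row_mult_def\<close>)
  qed (use B in auto)
  then have "A \<in> carrier_mat ?n ?n \<and> (\<forall>x\<in>carrier_vec ?n. \<forall>y\<in>carrier_vec ?n. ?B x y = (x \<^sub>v* A) \<bullet> y)
     \<longleftrightarrow> A \<in> carrier_mat ?n ?n \<and> (\<forall>x\<in>carrier_vec ?n. x \<^sub>v* A = f x)" for A
    by blast
  moreover have "f (x + y) = f x + f y" if "x \<in> carrier_vec ?n" "y \<in> carrier_vec ?n" for x y
    using that by (intro eq_vecI) (simp_all add: f_def add)
  ultimately show ?thesis
    using additive_map_ex1[of ?n f ?n] f by (simp only:)
qed

lemma W_mat:
  shows "W_mat p \<in> carrier_mat (degree p) (degree p)"
    and "x \<in> carrier_vec (degree p) \<Longrightarrow> y \<in> carrier_vec (degree p) \<Longrightarrow>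
           fld_trace p (fld_mult p x y) = (x \<^sub>v* W_mat p) \<bullet> y"
  using theI'[OF W_mat_ex1[of p]] unfolding W_mat_def by auto

lemma card_residues:
  assumes "m > 0"
  shows "finite {f :: bit poly. degree f < m}" "card {f :: bit poly. degree f < m} = 2 ^ m"
proof -
  let ?L = "{xs :: bit list. set xs \<subseteq> UNIV \<and> length xs = m}"
  let ?coeffs = "\<lambda>f. map (coeff f) [0..<m]"
  have U: "(UNIV :: bit set) = {0, 1}"
    using bit_not_zero_iff by blast
  have L: "finite ?L" "card ?L = 2 ^ m"
    using finite_lists_length_eq[of "UNIV :: bit set" m] card_lists_length_eq[of "UNIV :: bit set" m]
    by (simp_all add: U card_insert_if numeral_2_eq_2)
  have "bij_betw Poly ?L {f. degree f < m}"
  proof (rule bij_betw_byWitness[where f' = ?coeffs])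
    show "\<forall>xs\<in>?L. ?coeffs (Poly xs) = xs"
      by (auto simp: coeff_Poly_eq nth_default_def intro!: nth_equalityI)
    show "\<forall>f\<in>{f. degree f < m}. Poly (?coeffs f) = f"
      by (auto simp: coeff_Poly_eq nth_default_def coeff_eq_0 intro!: poly_eqI)
    show "Poly ` ?L \<subseteq> {f. degree f < m}"
    proof clarify
      fix xs :: "bit list" assume len: "m = length xs"
      show "degree (Poly xs) < length xs"
        using assms len degree_Poly[of xs]
        by (metis (no_types) coeff_Poly_eq degree_0 leading_coeff_0_iff linorder_not_less nth_default_beyond)
    qed
    show "?coeffs ` {f. degree f < m} \<subseteq> ?L" by auto
  qed
  with L show "finite {f :: bit poly. degree f < m}" "card {f :: bit poly. degree f < m} = 2 ^ m"
    using bij_betw_finite bij_betw_same_card by (blast, metis)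
qed

lemma fermat_residue:
  fixes p x :: "bit poly"
  assumes "irreducible p"
  shows "p dvd x ^ (2 ^ degree p) - x"
proof (cases "p dvd x")
  case True
  have "(2::nat) ^ degree p \<noteq> 0" by simp
  with True show ?thesis by (meson dvd_diff dvd_power_same dvd_trans dvd_power zero_less_iff_neq_zero gr0I)
next
  case False
  have prime: "prime_elem p" using assms by (rule field_poly_irreducible_imp_prime)
  have deg: "degree p > 0"
    using assms by (metis irreducible_def is_unit_iff_degree gr0I)
  define S where "S = {f :: bit poly. degree f < degree p} - {0}"
  have fin: "finite S" and card: "card S = 2 ^ degree p - 1"
    using card_residues[OF deg] deg by (auto simp: S_def card_Diff_subset)
  have S: "\<not> p dvd f" if "f \<in> S" for f
    using that dvd_imp_degree_le[of p f] by (auto simp: S_def)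
  let ?h = "\<lambda>f. (x * f) mod p"
  have "inj_on ?h S"
  proof (rule inj_onI)
    fix f g assume fg: "f \<in> S" "g \<in> S" "?h f = ?h g"
    then have "p dvd x * (f - g)"
      by (simp add: mod_eq_dvd_iff right_diff_distrib)
    then have "p dvd f - g" using prime False by (auto simp: prime_elem_dvd_mult_iff)
    moreover have "degree (f - g) < degree p"
      using fg by (auto simp: S_def intro: degree_diff_less)
    ultimately show "f = g" using dvd_imp_degree_le[of p "f - g"] by force
  qed
  moreover have "?h ` S \<subseteq> S"
  proof clarify
    fix f assume "f \<in> S"
    then have "\<not> p dvd x * f" using S prime False by (auto simp: prime_elem_dvd_mult_iff)
    then show "?h f \<in> S"
      using deg degree_mod_less'[of p "x * f"] by (cases "p = 0") (auto simp: S_def mod_eq_0_iff_dvd)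
  qed
  ultimately have "bij_betw ?h S S"
    using fin by (simp add: bij_betw_def endo_inj_surj)
  then have "(\<Prod>f\<in>S. ?h f) = \<Prod>S"
    by (rule prod.reindex_bij_betw)
  then have "\<Prod>S mod p = (\<Prod>f\<in>S. x * f) mod p"
    using mod_prod_eq[of "\<lambda>f. x * f" p S] by simp
  then have "p dvd (x ^ (2 ^ degree p - 1) - 1) * \<Prod>S"
    by (simp add: mod_eq_dvd_iff prod.distrib card left_diff_distrib dvd_diff_commute)
  moreover have "\<not> p dvd \<Prod>S"
    using fin S prime
    by (induction S rule: finite_induct) (auto simp: prime_elem_dvd_mult_iff)
  ultimately have "p dvd x ^ (2 ^ degree p - 1) - 1"
    using prime by (auto simp: prime_elem_dvd_mult_iff)
  then have "p dvd x * (x ^ (2 ^ degree p - 1) - 1)" by simp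
  moreover have "x * x ^ (2 ^ degree p - 1) = x ^ (2 ^ degree p)"
    using power_Suc[of x "2 ^ degree p - 1"] by simp
  ultimately show ?thesis by (simp add: right_diff_distrib)
qed

lemma trace_const:
  assumes "irreducible p"
  shows "(\<Sum>i<degree p. poly_of x ^ (2 ^ i)) mod p = [:fld_trace p x:]"
proof -
  define f where "f = poly_of x"
  let ?t = "\<lambda>n. \<Sum>i<n. f ^ (2 ^ i)"
  let ?T = "?t (degree p)"
  have "(?t n)\<^sup>2 - ?t n = f ^ (2 ^ n) - f" for n
  proof (induction n)
    case (Suc n)
    have "(?t (Suc n))\<^sup>2 - ?t (Suc n) = ((?t n)\<^sup>2 - ?t n) + ((f ^ (2 ^ n))\<^sup>2 - f ^ (2 ^ n))"
      by (simp add: bit_poly_square_add)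
    also have "\<dots> = f ^ (2 ^ Suc n) - f"
      unfolding Suc by (simp add: mult.commute flip: power_mult)
    finally show ?case .
  qed simp
  then have "?T * (?T - 1) = f ^ (2 ^ degree p) - f"
    by (simp add: power2_eq_square right_diff_distrib)
  then have "p dvd ?T * (?T - 1)"
    using fermat_residue[OF assms, of f] by simp
  then have "p dvd ?T \<or> p dvd ?T - 1"
    using field_poly_irreducible_imp_prime[OF assms] by (auto simp: prime_elem_dvd_mult_iff)
  moreover have "1 mod p = 1"
    using assms by (metis irreducible_def is_unit_iff_degree degree_1 gr0I mod_poly_less)
  ultimately have "?T mod p \<in> {0, 1}"
    by (auto simp: mod_eq_dvd_iff[of ?T p 1, symmetric] mod_eq_0_iff_dvd)
  then show ?thesis
    by (auto simp: fld_trace_def f_def one_pCons)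
qed


section \<open>The groups generated by the Kerdock symmetries\<close>

definition PK_common :: "bit poly \<Rightarrow> bit mat set" where
  "PK_common p =
     {T_mat (A_mat p x ^\<^sub>m 2 * W_mat p) | x. x \<in> carrier_vec (degree p)} \<union>
     {Omega (degree p) * L_mat (inv_mat (W_mat p))}"

definition PK_gens :: "bit poly \<Rightarrow> bit mat set" where
  "PK_gens p = PK_common p \<union>
     {L_mat (inv_mat (A_mat p x)) | x. x \<in> carrier_vec (degree p) - {0\<^sub>v (degree p)}}"

definition PK_star_gens :: "bit poly \<Rightarrow> bit mat set" where
  "PK_star_gens p = PK_common p \<union>
     {L_mat (inv_mat (R_mat p) ^\<^sub>m i * inv_mat (A_mat p x)) | x i.
        x \<in> carrier_vec (degree p) - {0\<^sub>v (degree p)} \<and> i < degree p}"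

definition PK :: "bit poly \<Rightarrow> bit mat monoid" where
  "PK p = (Sp (degree p))\<lparr>carrier := generate (Sp (degree p)) (PK_gens p)\<rparr>"

definition PK_star :: "bit poly \<Rightarrow> bit mat monoid" where
  "PK_star p = (Sp (degree p))\<lparr>carrier := generate (Sp (degree p)) (PK_star_gens p)\<rparr>"

end

theory Submission
  imports Defs
begin

text \<open>
  By the commutation relation \<open>X\<^sup>aZ\<^sup>b X\<^sup>cZ\<^sup>d = (-1)\<^bsup>ad+bc\<^esup> X\<^sup>cZ\<^sup>d X\<^sup>aZ\<^sup>b\<close> in each tensor factor, two vertices commute
  iff they are orthogonal for the symplectic form \<open>\<langle>u, v\<rangle> = u \<Omega> v\<^sup>T\<close>, and \<open>Sp(2m)\<close> is the isometry
  group of this form. If \<open>\<langle>v, w\<rangle> = 1\<close>, the transvection \<open>x \<mapsto> x + \<langle>x, v + w\<rangle> (v + w)\<close> maps \<open>v\<close> to \<open>w\<close>,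
  and it fixes every \<open>u\<close> with \<open>\<langle>u, v\<rangle> = \<langle>u, w\<rangle>\<close>. If \<open>\<langle>v, v'\<rangle> = 0\<close>, one passes through some \<open>w\<close> with
  \<open>\<langle>v, w\<rangle> = \<langle>v', w\<rangle> = 1\<close> and a prescribed value \<open>\<langle>u, w\<rangle>\<close>. This gives transitivity on vertices and
  on ordered pairs with a given value of the form.

  For the Kerdock groups, \<open>[a, b]\<close> with \<open>a \<noteq> 0\<close> is mapped to \<open>[a, a x\<^sup>2 W + b]\<close>. Every field element is
  a square and \<open>W\<close> is invertible, so \<open>x\<close> can be chosen such that the image is \<open>[a, 0]\<close>, and dividing
  by \<open>a\<close> gives \<open>[1, 0]\<close>. The generator \<open>\<Omega> L\<close> turns \<open>[0, b]\<close> into a vertex with nonzero first half.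
\<close>

section \<open>Right actions and invertible matrices\<close>

lemma bit_add_self: "b + b = (0 :: bit)"
  by (cases b) simp_all

lemma bit_vec_add_self: "v \<in> carrier_vec n \<Longrightarrow> v + v = (0\<^sub>v n :: bit vec)"
  by (intro eq_vecI) (auto simp: bit_add_self simp del: add_bit_eq_xor)

lemma bit_vec_add_cancel:
  fixes u v :: "bit vec"
  assumes "u \<in> carrier_vec n" "v \<in> carrier_vec n"
  shows "u + (u + v) = v" and "v + (u + v) = u"
  using assms by (simp_all add: assoc_add_vec[of _ n, symmetric] comm_add_vec[of v n u] bit_vec_add_self)

lemma bit_vec_add_eq_0_iff:
  fixes u v :: "bit vec"
  assumes "u \<in> carrier_vec n" "v \<in> carrier_vec n"
  shows "u + v = 0\<^sub>v n \<longleftrightarrow> u = v"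
  using assms bit_vec_add_cancel(1)[OF assms] bit_vec_add_self[OF assms(1)] by auto

section \<open>Row vectors times matrices\<close>

lemma row_mult_one [simp]: "(v :: 'a :: comm_semiring_1 vec) \<in> carrier_vec n \<Longrightarrow> v \<^sub>v* 1\<^sub>m n = v"
  by (simp add: row_mult_def)

lemma row_mult_mult:
  assumes "v \<in> carrier_vec a" "A \<in> carrier_mat a b" "B \<in> carrier_mat b c"
  shows "v \<^sub>v* (A * B) = (v \<^sub>v* A) \<^sub>v* B"
  using assms by (simp add: row_mult_def transpose_mult[OF assms(2,3)] assoc_mult_mat_vec[of _ c b _ a])

lemma row_mult_scalar_prod:
  assumes "x \<in> carrier_vec a" "A \<in> carrier_mat a b" "y \<in> carrier_vec b"
  shows "(x \<^sub>v* A) \<bullet> y = x \<bullet> (A *\<^sub>v y)"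
  unfolding row_mult_def using assms transpose_vec_mult_scalar[of A a b y x]
  by (metis (no_types) comm_scalar_prod mult_mat_vec_carrier transpose_carrier_mat)

lemma row_mult_add:
  assumes "u \<in> carrier_vec n" "v \<in> carrier_vec n" "A \<in> carrier_mat n k"
  shows "(u + v) \<^sub>v* A = u \<^sub>v* A + v \<^sub>v* A"
  unfolding row_mult_def using assms by (intro mult_add_distrib_mat_vec[of _ k n]) auto

lemma row_mult_zero:
  assumes "A \<in> carrier_mat n k"
  shows "0\<^sub>v n \<^sub>v* A = 0\<^sub>v k"
  using assms by (intro eq_vecI) (auto simp: row_mult_index[of A n k])

lemma row_mult_four_block:
  assumes "A \<in> carrier_mat n k" "B \<in> carrier_mat n l" "C \<in> carrier_mat j k" "D \<in> carrier_mat j l"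
    and "a \<in> carrier_vec n" "b \<in> carrier_vec j"
  shows "(a @\<^sub>v b) \<^sub>v* four_block_mat A B C D
    = (a \<^sub>v* A + b \<^sub>v* C) @\<^sub>v (a \<^sub>v* B + b \<^sub>v* D)"
  unfolding row_mult_def transpose_four_block_mat[OF assms(1-4)]
  using assms by (intro four_block_mat_mult_vec) auto

section \<open>Inverse matrices over a field\<close>

text \<open>Turns invertibility of \<open>A_mat\<close>, \<open>R_mat\<close> and
  \<open>W_mat\<close> into an injectivity question about field operations. The kernel criterion for
  column vectors is applied to the transpose.\<close>

lemma det_nonzeroI:
  fixes A :: "'a :: field mat"
  assumes A: "A \<in> carrier_mat n n" and inj: "\<And>x. x \<in> carrier_vec n \<Longrightarrow> x \<^sub>v* A = 0\<^sub>v n \<Longrightarrow> x = 0\<^sub>v n"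
  shows "det A \<noteq> 0"
  using inj A det_0_iff_vec_prod_zero[of "transpose_mat A" n] by (auto simp: row_mult_def det_transpose)

text \<open>\<open>inv_mat\<close> applies \<open>the\<close> to an option value. A nonzero
  determinant makes the matrix a unit of the matrix ring, which excludes the value
  \<open>None\<close>.\<close>

lemma inv_mat:
  fixes A :: "'a :: field mat"
  assumes A: "A \<in> carrier_mat n n" and det: "det A \<noteq> 0"
  shows "inv_mat A \<in> carrier_mat n n" "A * inv_mat A = 1\<^sub>m n" "inv_mat A * A = 1\<^sub>m n"
proof -
  have "A \<in> Units (ring_mat TYPE('a) n ())"
    using A det by (rule det_non_zero_imp_unit)
  then obtain B where "mat_inverse A = Some B"
    using mat_inverse(1)[OF A, where b = "()"] by (cases "mat_inverse A") auto
  then show "inv_mat A \<in> carrier_mat n n" "A * inv_mat A = 1\<^sub>m n" "inv_mat A * A = 1\<^sub>m n"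
    using mat_inverse(2)[OF A] by auto
qed

lemma det_inv_mat:
  fixes A :: "'a :: field mat"
  assumes A: "A \<in> carrier_mat n n" and det: "det A \<noteq> 0"
  shows "det (inv_mat A) \<noteq> 0"
  using det_mult[OF A inv_mat(1)[OF A det]] inv_mat(2)[OF A det] by auto

lemma row_mult_inv_mat:
  fixes A :: "'a :: field mat"
  assumes A: "A \<in> carrier_mat n n" "det A \<noteq> 0" and x: "x \<in> carrier_vec n"
  shows "x \<^sub>v* A \<^sub>v* inv_mat A = x" "x \<^sub>v* inv_mat A \<^sub>v* A = x"
  using inv_mat[OF A] A x row_mult_mult[of x n A n "inv_mat A" n] row_mult_mult[of x n "inv_mat A" n A n]
  by simp_all

section \<open>Criteria for a transitive right action\<close>

text \<open>Each \<open>act _ g\<close> is a bijection of \<open>S\<close>, inverted by the action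
  of the group inverse of \<open>g\<close>. Acting by \<open>h\<close> followed by \<open>g\<close>
  is the composition of the map of \<open>g\<close> after the map of \<open>h\<close>, which is
  exactly the product order of \<open>opposite G\<close>.\<close>

lemma transitive_right_actionI:
  assumes G: "group G"
    and closed: "\<And>x g. x \<in> S \<Longrightarrow> g \<in> carrier G \<Longrightarrow> act x g \<in> S"
    and one: "\<And>x. x \<in> S \<Longrightarrow> act x \<one>\<^bsub>G\<^esub> = x"
    and mult: "\<And>x g h. x \<in> S \<Longrightarrow> g \<in> carrier G \<Longrightarrow> h \<in> carrier G \<Longrightarrow> act x (g \<otimes>\<^bsub>G\<^esub> h) = act (act x g) h"
    and trans: "\<And>x y. x \<in> S \<Longrightarrow> y \<in> S \<Longrightarrow> \<exists>g\<in>carrier G. act x g = y"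
  shows "transitive_right_action G S act"
proof -
  interpret G: group G by fact
  let ?\<phi> = "\<lambda>g. \<lambda>x\<in>S. act x g"
  have op: "group (opposite G)"
  proof (rule groupI)
    fix x assume "x \<in> carrier (opposite G)"
    then show "\<exists>y\<in>carrier (opposite G). y \<otimes>\<^bsub>opposite G\<^esub> x = \<one>\<^bsub>opposite G\<^esub>"
      by (intro bexI[of _ "inv\<^bsub>G\<^esub> x"]) (auto simp: opposite_def)
  qed (auto simp: opposite_def G.m_assoc)
  have Bij: "?\<phi> g \<in> Bij S" if g: "g \<in> carrier G" for g
  proof -
    have "bij_betw (\<lambda>x. act x g) S S"
      by (rule bij_betw_byWitness[where f' = "\<lambda>x. act x (inv\<^bsub>G\<^esub> g)"])
        (use g in \<open>auto simp: closed one simp flip: mult\<close>)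
    then show ?thesis by (simp add: Bij_def cong: bij_betw_cong)
  qed
  have "group_hom (opposite G) (BijGroup S) ?\<phi>"
  proof (intro group_hom.intro group_hom_axioms.intro op group_BijGroup homI)
    fix g h assume "g \<in> carrier (opposite G)" "h \<in> carrier (opposite G)"
    then show "?\<phi> (g \<otimes>\<^bsub>opposite G\<^esub> h) = ?\<phi> g \<otimes>\<^bsub>BijGroup S\<^esub> ?\<phi> h"
      by (auto simp: BijGroup_def Bij compose_def closed mult opposite_def intro!: restrict_ext)
  qed (auto simp: BijGroup_def Bij opposite_def)
  then show ?thesis
    unfolding transitive_right_action_def
    by (intro transitive_action.intro group_action.intro transitive_action_axioms.intro)
      (use trans in \<open>auto simp: opposite_def\<close>)
qed

text \<open>Go from \<open>x\<close> to \<open>x0\<close> by \<open>g\<close>, then back from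
  \<open>x0\<close> to \<open>y\<close> by the inverse of \<open>h\<close>.\<close>

lemma transitive_right_action_basepointI:
  assumes G: "group G"
    and closed: "\<And>x g. x \<in> S \<Longrightarrow> g \<in> carrier G \<Longrightarrow> act x g \<in> S"
    and one: "\<And>x. x \<in> S \<Longrightarrow> act x \<one>\<^bsub>G\<^esub> = x"
    and mult: "\<And>x g h. x \<in> S \<Longrightarrow> g \<in> carrier G \<Longrightarrow> h \<in> carrier G \<Longrightarrow> act x (g \<otimes>\<^bsub>G\<^esub> h) = act (act x g) h"
    and base: "\<And>x. x \<in> S \<Longrightarrow> \<exists>g\<in>carrier G. act x g = x0"
  shows "transitive_right_action G S act"
proof (rule transitive_right_actionI[OF G closed one mult])
  interpret G: group G by fact
  fix x y assume xy: "x \<in> S" "y \<in> S"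
  then obtain g h where gh: "g \<in> carrier G" "act x g = x0" "h \<in> carrier G" "act y h = x0"
    using base by meson
  \<comment> \<open>Writing \<open>x0\<close> as \<open>act y h\<close> lets the product law be
    applied at \<open>y\<close>, a point of \<open>S\<close>.\<close>
  have "act x (g \<otimes>\<^bsub>G\<^esub> inv\<^bsub>G\<^esub> h) = act (act y h) (inv\<^bsub>G\<^esub> h)"
    using xy gh by (simp add: mult)
  also have "\<dots> = act y (h \<otimes>\<^bsub>G\<^esub> inv\<^bsub>G\<^esub> h)"
    by (rule mult[symmetric]) (use xy gh in auto)
  also have "\<dots> = y" using xy gh by (simp add: one)
  finally have "act x (g \<otimes>\<^bsub>G\<^esub> inv\<^bsub>G\<^esub> h) = y" .
  then show "\<exists>g\<in>carrier G. act x g = y" using gh by blast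
qed


section \<open>Symplectic transvections\<close>

definition symp_form :: "nat \<Rightarrow> bit vec \<Rightarrow> bit vec \<Rightarrow> bit" where
  "symp_form m u v = (u \<^sub>v* Omega m) \<bullet> v"

lemma row_mult_Omega_carrier [simp]: "v \<^sub>v* Omega m \<in> carrier_vec (2 * m)"
  by (rule row_mult_carrier[OF Omega_carrier])

lemma row_mult_Omega:
  assumes "a \<in> carrier_vec m" "b \<in> carrier_vec m"
  shows "(a @\<^sub>v b) \<^sub>v* Omega m = b @\<^sub>v a"
  unfolding Omega_def using assms
  by (subst row_mult_four_block[of _ m m _ m _ m]) (auto simp: row_mult_def)

lemma symp_form_append:
  assumes "a \<in> carrier_vec m" "b \<in> carrier_vec m" "c \<in> carrier_vec m" "d \<in> carrier_vec m"
  shows "symp_form m (a @\<^sub>v b) (c @\<^sub>v d) = a \<bullet> d + b \<bullet> c"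
  using assms
  by (simp add: symp_form_def row_mult_Omega scalar_prod_append[of _ m _ m] add.commute
      del: add_bit_eq_xor)

lemma hw_vector_cases:
  fixes u :: "bit vec"
  assumes "u \<in> carrier_vec (2 * m)"
  obtains a b where "a \<in> carrier_vec m" "b \<in> carrier_vec m" "u = a @\<^sub>v b"
  using vec_first_last_append[of u m m] assms by (metis mult_2 vec_first_carrier vec_last_carrier)

lemma symp_form_add_left:
  assumes "u \<in> carrier_vec (2 * m)" "v \<in> carrier_vec (2 * m)" "w \<in> carrier_vec (2 * m)"
  shows "symp_form m (u + v) w = symp_form m u w + symp_form m v w"
  unfolding symp_form_def row_mult_add[OF assms(1,2) Omega_carrier]
  using assms by (intro add_scalar_prod_distrib[of _ "2 * m"]) auto

lemma symp_form_add_right: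
  assumes "u \<in> carrier_vec (2 * m)" "v \<in> carrier_vec (2 * m)" "w \<in> carrier_vec (2 * m)"
  shows "symp_form m w (u + v) = symp_form m w u + symp_form m w v"
  unfolding symp_form_def
  using assms by (intro scalar_prod_add_distrib[of _ "2 * m"]) auto

lemma symp_form_zero [simp]: "symp_form m (0\<^sub>v (2 * m)) v = 0" if "v \<in> carrier_vec (2 * m)"
  using that by (simp add: symp_form_def row_mult_zero[OF Omega_carrier])

lemma symp_form_smult_left:
  assumes "u \<in> carrier_vec (2 * m)" "w \<in> carrier_vec (2 * m)"
  shows "symp_form m (c \<cdot>\<^sub>v u) w = c * symp_form m u w"
proof (cases c)
  case zero
  have "0 \<cdot>\<^sub>v u = 0\<^sub>v (2 * m)" using assms by (intro eq_vecI) auto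
  then show ?thesis using zero assms by simp
qed simp

lemma symp_form_commute:
  assumes "u \<in> carrier_vec (2 * m)" "v \<in> carrier_vec (2 * m)"
  shows "symp_form m u v = symp_form m v u"
  using assms
  by (elim hw_vector_cases)
    (auto simp: symp_form_append comm_scalar_prod add.commute simp del: add_bit_eq_xor)

text \<open>For u = [a, b] the value is a.b + b.a, which is zero in characteristic 2: the form is
  alternating, not merely symmetric.\<close>

lemma symp_form_self:
  assumes "u \<in> carrier_vec (2 * m)"
  shows "symp_form m u u = 0"
  using assms
  by (elim hw_vector_cases)
    (auto simp: symp_form_append comm_scalar_prod bit_add_self simp del: add_bit_eq_xor)

text \<open>If every value were 0, unit vectors would show that u \<Omega> = 0, and \<Omega> is its
  own inverse.\<close>

lemma symp_form_nondegenerate: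
  fixes u :: "bit vec"
  assumes u: "u \<in> carrier_vec (2 * m)" "u \<noteq> 0\<^sub>v (2 * m)"
  obtains w where "w \<in> carrier_vec (2 * m)" "symp_form m u w = 1"
proof (rule ccontr)
  assume "\<not> thesis"
  with that have *: "symp_form m u w = 0" if "w \<in> carrier_vec (2 * m)" for w
    using that by (metis bit_not_one_iff)
  have "u \<^sub>v* Omega m = 0\<^sub>v (2 * m)"
  proof (rule eq_vecI)
    fix i assume "i < dim_vec (0\<^sub>v (2 * m) :: bit vec)"
    then show "(u \<^sub>v* Omega m) $ i = 0\<^sub>v (2 * m) $ i"
      using *[of "unit_vec (2 * m) i"] row_mult_Omega_carrier[of u m]
      by (simp add: symp_form_def)
  qed (use row_mult_Omega_carrier[of u m] in auto)
  then have "u \<^sub>v* (Omega m * Omega m) = 0\<^sub>v (2 * m)"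
    using u by (simp add: row_mult_mult[OF _ Omega_carrier Omega_carrier] row_mult_zero[OF Omega_carrier])
  with u show False by (simp add: Omega_Omega)
qed

section \<open>The symplectic group as isometry group\<close>

text \<open>The form at uF and vF is the bilinear form of the matrix F \<Omega> F^T at u and v, and
  unit vectors recover a matrix from its bilinear form. Membership in \<open>Sp m\<close> is checked
  through this criterion below.\<close>

lemma Sp_iff_preserves_symp_form:
  assumes F: "F \<in> carrier_mat (2 * m) (2 * m)"
  shows "F \<in> carrier (Sp m) \<longleftrightarrow>
    (\<forall>u\<in>carrier_vec (2 * m). \<forall>v\<in>carrier_vec (2 * m). symp_form m (u \<^sub>v* F) (v \<^sub>v* F) = symp_form m u v)"
proof -
  let ?V = "carrier_vec (2 * m) :: bit vec set"
  have eq: "symp_form m (u \<^sub>v* F) (v \<^sub>v* F) = (u \<^sub>v* (F * Omega m * transpose_mat F)) \<bullet> v"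
    if uv: "u \<in> ?V" "v \<in> ?V" for u v
  proof -
    have FO: "F * Omega m \<in> carrier_mat (2 * m) (2 * m)" using F by simp
    have "(u \<^sub>v* (F * Omega m * transpose_mat F)) \<bullet> v = (u \<^sub>v* (F * Omega m) \<^sub>v* transpose_mat F) \<bullet> v"
      using uv F FO by (simp add: row_mult_mult[of u "2 * m" _ "2 * m" _ "2 * m"])
    also have "\<dots> = (u \<^sub>v* (F * Omega m)) \<bullet> (v \<^sub>v* F)"
      using uv F row_mult_scalar_prod[OF row_mult_carrier[OF FO], of "transpose_mat F" "2 * m" v]
      by (simp add: row_mult_def)
    also have "u \<^sub>v* (F * Omega m) = u \<^sub>v* F \<^sub>v* Omega m"
      using uv F by (simp add: row_mult_mult[of u "2 * m" _ "2 * m" _ "2 * m"])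
    finally show ?thesis by (simp add: symp_form_def)
  qed
  show ?thesis
  proof
    assume "F \<in> carrier (Sp m)"
    then show "\<forall>u\<in>?V. \<forall>v\<in>?V. symp_form m (u \<^sub>v* F) (v \<^sub>v* F) = symp_form m u v"
      using eq by (simp add: Sp_def symp_form_def)
  next
    assume pres: "\<forall>u\<in>?V. \<forall>v\<in>?V. symp_form m (u \<^sub>v* F) (v \<^sub>v* F) = symp_form m u v"
    let ?G = "F * Omega m * transpose_mat F"
    have G: "?G \<in> carrier_mat (2 * m) (2 * m)" using F by (intro mult_carrier_mat) auto
    have "?G = Omega m"
    proof (rule eq_matI)
      fix i j assume "i < dim_row (Omega m)" "j < dim_col (Omega m)"
      then have ij: "i < 2 * m" "j < 2 * m" using Omega_carrier[of m] by auto
      let ?e = "unit_vec (2 * m) :: nat \<Rightarrow> bit vec"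
      have "(?e i \<^sub>v* ?G) \<bullet> ?e j = (?e i \<^sub>v* Omega m) \<bullet> ?e j"
        using pres eq[of "?e i" "?e j"] by (simp add: symp_form_def)
      then have "(?e i \<^sub>v* ?G) $ j = (?e i \<^sub>v* Omega m) $ j"
        using ij row_mult_carrier[OF G, of "?e i"] row_mult_Omega_carrier[of "?e i" m] by simp
      then show "?G $$ (i, j) = Omega m $$ (i, j)"
        using ij by (simp add: row_mult_unit[OF G] row_mult_unit[OF Omega_carrier])
    qed (use carrier_matD[OF G] carrier_matD[OF Omega_carrier[of m]] in \<open>simp_all only:\<close>)
    then show "F \<in> carrier (Sp m)" using F by (simp add: Sp_def)
  qed
qed

lemma Sp_simps [simp]:
  "F \<otimes>\<^bsub>Sp m\<^esub> G = F * G" "\<one>\<^bsub>Sp m\<^esub> = 1\<^sub>m (2 * m)"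
  by (simp_all add: Sp_def)

lemma Sp_carrier_mat: "F \<in> carrier (Sp m) \<Longrightarrow> F \<in> carrier_mat (2 * m) (2 * m)"
  by (simp add: Sp_def)

lemma row_mult_Sp_carrier [simp]: "F \<in> carrier (Sp m) \<Longrightarrow> v \<^sub>v* F \<in> carrier_vec (2 * m)"
  by (rule row_mult_carrier[OF Sp_carrier_mat])

lemma symp_form_Sp:
  assumes "F \<in> carrier (Sp m)" "u \<in> carrier_vec (2 * m)" "v \<in> carrier_vec (2 * m)"
  shows "symp_form m (u \<^sub>v* F) (v \<^sub>v* F) = symp_form m u v"
  using Sp_iff_preserves_symp_form[OF Sp_carrier_mat] assms by blast

lemma inj_row_mult_Sp:
  assumes F: "F \<in> carrier (Sp m)"
  shows "inj_on (\<lambda>v. v \<^sub>v* F) (carrier_vec (2 * m))"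
proof (rule inj_on_inverseI)
  interpret Sp: group "Sp m" by (rule group_Sp)
  fix v :: "bit vec" assume v: "v \<in> carrier_vec (2 * m)"
  have "v \<^sub>v* (F * inv\<^bsub>Sp m\<^esub> F) = v"
    using Sp.r_inv[OF F] v by simp
  then show "v \<^sub>v* F \<^sub>v* inv\<^bsub>Sp m\<^esub> F = v"
    using row_mult_mult[OF v Sp_carrier_mat[OF F] Sp_carrier_mat[OF Sp.inv_closed[OF F]]] by simp
qed

lemma hw_vertices_Sp:
  assumes F: "F \<in> carrier (Sp m)" and v: "v \<in> hw_vertices m"
  shows "v \<^sub>v* F \<in> hw_vertices m"
proof -
  have "0\<^sub>v (2 * m) \<^sub>v* F = 0\<^sub>v (2 * m)"
    by (rule row_mult_zero[OF Sp_carrier_mat[OF F]])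
  then show ?thesis
    using inj_onD[OF inj_row_mult_Sp[OF F], of v "0\<^sub>v (2 * m)"] v
    by (auto simp: hw_vertices_def F)
qed

section \<open>Transvections\<close>

text \<open>Over F_2 an additive map is already linear, so it has a matrix. The form is preserved
  because \<langle>w, w\<rangle> = 0 and the two cross terms, both equal to \<langle>u,
  w\<rangle>\<langle>v, w\<rangle>, cancel.\<close>

lemma transvection_exists:
  assumes w: "w \<in> carrier_vec (2 * m)"
  obtains F where "F \<in> carrier (Sp m)"
    "\<And>v. v \<in> carrier_vec (2 * m) \<Longrightarrow> v \<^sub>v* F = v + symp_form m v w \<cdot>\<^sub>v w"
proof -
  let ?V = "carrier_vec (2 * m) :: bit vec set"
  let ?f = "\<lambda>v. v + symp_form m v w \<cdot>\<^sub>v w"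
  have add: "?f (u + v) = ?f u + ?f v" if "u \<in> ?V" "v \<in> ?V" for u v
    using that w
    by (intro eq_vecI)
      (auto simp: symp_form_add_left distrib_right add_ac simp del: add_bit_eq_xor mult_bit_eq_and)
  have "\<exists>!F. F \<in> carrier_mat (2 * m) (2 * m) \<and> (\<forall>v\<in>?V. v \<^sub>v* F = ?f v)"
    by (rule additive_map_ex1[OF add]) (use w in auto)
  then obtain F where F: "F \<in> carrier_mat (2 * m) (2 * m)" "\<And>v. v \<in> ?V \<Longrightarrow> v \<^sub>v* F = ?f v"
    by auto
  have "symp_form m (?f u) (?f v) = symp_form m u v" if uv: "u \<in> ?V" "v \<in> ?V" for u v
  proof -
    have sym: "symp_form m w v = symp_form m v w" using w uv by (intro symp_form_commute)
    have right: "symp_form m x (c \<cdot>\<^sub>v w) = c * symp_form m x w" if "x \<in> ?V" for x c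
      using that w symp_form_smult_left[of w m x c] symp_form_commute[of x m "c \<cdot>\<^sub>v w"]
        symp_form_commute[of x m w] by simp
    \<comment> \<open>The part of \<open>?f u\<close> along \<open>w\<close> drops out since
      \<open>w\<close> is orthogonal to itself. The scalar \<open>c\<close> becomes \<langle>v,
      w\<rangle> below.\<close>
    have "symp_form m (?f u) (c \<cdot>\<^sub>v w) = c * symp_form m u w" for c
      using uv w by (simp add: right symp_form_add_left symp_form_smult_left symp_form_self
          del: add_bit_eq_xor mult_bit_eq_and)
    moreover have "symp_form m (?f u) v = symp_form m u v + symp_form m u w * symp_form m v w"
      using uv w by (simp add: symp_form_add_left symp_form_smult_left sym
          del: add_bit_eq_xor mult_bit_eq_and)
    ultimately have "symp_form m (?f u) (?f v)
      = symp_form m u v + symp_form m u w * symp_form m v w + symp_form m v w * symp_form m u w"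
      using uv w by (simp add: symp_form_add_right del: add_bit_eq_xor mult_bit_eq_and)
    also have "\<dots> = symp_form m u v"
      by (simp only: add.assoc mult.commute[of "symp_form m v w"] bit_add_self add_0_right)
    finally show ?thesis .
  qed
  then have "F \<in> carrier (Sp m)"
    by (subst Sp_iff_preserves_symp_form[OF F(1)]) (auto simp: F(2))
  with F(2) that show thesis by blast
qed

text \<open>For \<open>u = 0\<close> this moves a single vector.\<close>

lemma Sp_move_nonorthogonal:
  assumes "u \<in> carrier_vec (2 * m)" "v \<in> carrier_vec (2 * m)" "w \<in> carrier_vec (2 * m)"
    and "symp_form m v w = 1" "symp_form m u v = symp_form m u w"
  obtains F where "F \<in> carrier (Sp m)" "u \<^sub>v* F = u" "v \<^sub>v* F = w"
proof -
  obtain F where F: "F \<in> carrier (Sp m)"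
    "\<And>x. x \<in> carrier_vec (2 * m) \<Longrightarrow> x \<^sub>v* F = x + symp_form m x (v + w) \<cdot>\<^sub>v (v + w)"
    using transvection_exists[of "v + w" m] assms by auto
  have "symp_form m u (v + w) = 0" "symp_form m v (v + w) = 1"
    using assms by (simp_all add: symp_form_add_right symp_form_self bit_add_self del: add_bit_eq_xor)
  then have "u \<^sub>v* F = u" "v \<^sub>v* F = w"
    using assms by (auto simp: F(2) bit_vec_add_cancel[of _ "2 * m"] intro!: eq_vecI)
  with F(1) that show thesis by blast
qed

section \<open>Vectors with prescribed values of the form\<close>

text \<open>Take one witness for \<open>a\<close> and one for \<open>b\<close>. If neither serves
  both, each is orthogonal to the other vector, and their sum serves both.\<close>

lemma symp_form_separation2:
  assumes a: "a \<in> carrier_vec (2 * m)" "a \<noteq> 0\<^sub>v (2 * m)" and b: "b \<in> carrier_vec (2 * m)" "b \<noteq> 0\<^sub>v (2 * m)"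
  obtains w where "w \<in> carrier_vec (2 * m)" "symp_form m a w = 1" "symp_form m b w = 1"
proof -
  obtain w1 where w1: "w1 \<in> carrier_vec (2 * m)" "symp_form m a w1 = 1"
    using symp_form_nondegenerate[OF a] by blast
  obtain w2 where w2: "w2 \<in> carrier_vec (2 * m)" "symp_form m b w2 = 1"
    using symp_form_nondegenerate[OF b] by blast
  consider "symp_form m b w1 = 1" | "symp_form m a w2 = 1"
    | "symp_form m b w1 = 0" "symp_form m a w2 = 0"
    using bit_not_one_iff by blast
  then show thesis
    by cases (use w1 w2 a b that[of w1] that[of w2] that[of "w1 + w2"] in \<open>auto simp: symp_form_add_right\<close>)
qed

text \<open>A \<open>w\<close> taking the value 1 on both x and a + x is orthogonal to a, and both
  vectors are nonzero as x is neither 0 nor a. The witnesses obtained for x = b and x = c are then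
  combined as in the case of two vectors.\<close>

lemma symp_form_separation3:
  assumes a: "a \<in> carrier_vec (2 * m)" and b: "b \<in> carrier_vec (2 * m)" "b \<notin> {0\<^sub>v (2 * m), a}"
    and c: "c \<in> carrier_vec (2 * m)" "c \<notin> {0\<^sub>v (2 * m), a}"
  obtains w where "w \<in> carrier_vec (2 * m)"
    "symp_form m a w = 0" "symp_form m b w = 1" "symp_form m c w = 1"
proof -
  have ex: "\<exists>w. w \<in> carrier_vec (2 * m) \<and> symp_form m a w = 0 \<and> symp_form m x w = 1"
    if x: "x \<in> carrier_vec (2 * m)" "x \<notin> {0\<^sub>v (2 * m), a}" for x
  proof -
    have "a + x \<noteq> 0\<^sub>v (2 * m)" using bit_vec_add_eq_0_iff[OF a x(1)] x(2) by auto
    then obtain w where w: "w \<in> carrier_vec (2 * m)" "symp_form m x w = 1" "symp_form m (a + x) w = 1"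
      using symp_form_separation2[of x m "a + x"] x a by auto
    then have "symp_form m a w + 1 = 1"
      using symp_form_add_left[OF a x(1) w(1)] by (simp del: add_bit_eq_xor)
    then have "symp_form m a w = 0" by (simp del: add_bit_eq_xor)
    with w show ?thesis by blast
  qed
  obtain w1 where w1: "w1 \<in> carrier_vec (2 * m)" "symp_form m a w1 = 0" "symp_form m b w1 = 1"
    using ex[OF b] by blast
  obtain w2 where w2: "w2 \<in> carrier_vec (2 * m)" "symp_form m a w2 = 0" "symp_form m c w2 = 1"
    using ex[OF c] by blast
  consider "symp_form m c w1 = 1" | "symp_form m b w2 = 1"
    | "symp_form m c w1 = 0" "symp_form m b w2 = 0"
    using bit_not_one_iff by blast
  then show thesis
    by cases (use w1 w2 a b c that[of w1] that[of w2] that[of "w1 + w2"] in \<open>auto simp: symp_form_add_right\<close>)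
qed

section \<open>Transitivity of the symplectic group\<close>

lemma Sp_mult_closed: "F \<in> carrier (Sp m) \<Longrightarrow> G \<in> carrier (Sp m) \<Longrightarrow> F * G \<in> carrier (Sp m)"
  using group.subgroup_self[OF group_Sp] subgroup.m_closed by fastforce

lemma row_mult_Sp_mult:
  assumes "v \<in> carrier_vec (2 * m)" "F \<in> carrier (Sp m)" "G \<in> carrier (Sp m)"
  shows "v \<^sub>v* (F * G) = v \<^sub>v* F \<^sub>v* G"
  using assms by (intro row_mult_mult[of _ "2 * m" _ "2 * m" _ "2 * m"]) (auto simp: Sp_carrier_mat)

text \<open>Composes the moves from \<open>v\<close> to \<open>w\<close> and from \<open>w\<close>
  to \<open>v'\<close>. This serves orthogonal \<open>v\<close> and \<open>v'\<close>, where the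
  transvection along \<open>v + v'\<close> leaves \<open>v\<close> in place.\<close>

lemma Sp_move_via:
  assumes V: "u \<in> carrier_vec (2 * m)" "v \<in> carrier_vec (2 * m)" "v' \<in> carrier_vec (2 * m)" "w \<in> carrier_vec (2 * m)"
    and vw: "symp_form m v w = 1" "symp_form m v' w = 1"
    and uw: "symp_form m u v = symp_form m u w" "symp_form m u v' = symp_form m u w"
  obtains F where "F \<in> carrier (Sp m)" "u \<^sub>v* F = u" "v \<^sub>v* F = v'"
proof -
  obtain F where F: "F \<in> carrier (Sp m)" "u \<^sub>v* F = u" "v \<^sub>v* F = w"
    using Sp_move_nonorthogonal[OF V(1,2,4) vw(1) uw(1)] by blast
  moreover have "symp_form m w v' = 1" using symp_form_commute[OF V(4,3)] vw(2) by simp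
  then obtain G where "G \<in> carrier (Sp m)" "u \<^sub>v* G = u" "w \<^sub>v* G = v'"
    using Sp_move_nonorthogonal[OF V(1,4,3) _ uw(2)[symmetric]] by blast
  ultimately show thesis
    using that[of "F * G"] V by (simp add: Sp_mult_closed row_mult_Sp_mult)
qed

lemma Sp_transitive_nonzero:
  assumes "v \<in> hw_vertices m" "v' \<in> hw_vertices m"
  obtains F where "F \<in> carrier (Sp m)" "v \<^sub>v* F = v'"
proof -
  obtain w where "w \<in> carrier_vec (2 * m)" "symp_form m v w = 1" "symp_form m v' w = 1"
    using symp_form_separation2[of v m v'] assms by (auto simp: hw_vertices_def)
  \<comment> \<open>With \<open>u = 0\<close> both conditions on \<open>u\<close> read 0 =
    0.\<close>
  then show thesis
    using Sp_move_via[of "0\<^sub>v (2 * m)" m v v' w] assms that by (auto simp: hw_vertices_def)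
qed

text \<open>An intermediate vector \<open>w\<close> is required only for distinct orthogonal
  \<open>v\<close> and \<open>v'\<close>. It has to satisfy \<langle>v, w\<rangle> = \<langle>v',
  w\<rangle> = 1 and \<langle>u, w\<rangle> = \<langle>u, v\<rangle>, hence the distinction by the
  value of \<langle>u, v\<rangle>.\<close>

lemma Sp_transitive_pairs_fixed:
  assumes u: "u \<in> hw_vertices m" and v: "v \<in> hw_vertices m" "v \<noteq> u" and v': "v' \<in> hw_vertices m" "v' \<noteq> u"
    and eq: "symp_form m u v = symp_form m u v'"
  obtains F where "F \<in> carrier (Sp m)" "u \<^sub>v* F = u" "v \<^sub>v* F = v'"
proof -
  note hw_vertices_def [simp]
  have V: "u \<in> carrier_vec (2 * m)" "v \<in> carrier_vec (2 * m)" "v' \<in> carrier_vec (2 * m)"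
    using u v v' by auto
  consider "v = v'" | "symp_form m v v' = 1" | "v \<noteq> v'" "symp_form m v v' = 0" "symp_form m u v = 0"
    | "v \<noteq> v'" "symp_form m v v' = 0" "symp_form m u v = 1"
    by (cases "symp_form m v v'"; cases "symp_form m u v") auto
  then show thesis
  proof cases
    case 1
    then show ?thesis
      using that[of "1\<^sub>m (2 * m)"] V group.is_monoid[OF group_Sp] monoid.one_closed[of "Sp m"] by simp
  next
    case 2
    then show ?thesis using Sp_move_nonorthogonal[OF V] eq that by blast
  next
    case 3
    obtain w where w: "w \<in> carrier_vec (2 * m)"
      "symp_form m u w = 0" "symp_form m v w = 1" "symp_form m v' w = 1"
      using symp_form_separation3[OF V(1,2) _ V(3)] u v v' by auto
    show ?thesis
      by (rule Sp_move_via[OF V w(1)]) (use w(2-4) 3 eq that in auto)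
  next
    case 4
    \<comment> \<open>Now \<open>w\<close> must take the value 1 on \<open>u\<close>,
      \<open>v\<close> and \<open>v'\<close>, that is, 0 on \<open>v + v'\<close> and 1 on
      \<open>u\<close> and \<open>v\<close>. Separation applies once \<open>u\<close> and
      \<open>v\<close> are known to differ from \<open>v + v'\<close>.\<close>
    have "u \<noteq> v + v'"
    proof
      assume "u = v + v'"
      then have "symp_form m u v = symp_form m v' v"
        using V by (simp add: symp_form_add_left symp_form_self del: add_bit_eq_xor)
      then show False using 4 V symp_form_commute[of v m v'] by simp
    qed
    moreover have "v \<noteq> v + v'"
      using v v' V bit_vec_add_cancel(1)[OF V(2,3)] bit_vec_add_self[OF V(2)] by auto
    ultimately obtain w where w: "w \<in> carrier_vec (2 * m)"
      "symp_form m (v + v') w = 0" "symp_form m u w = 1" "symp_form m v w = 1"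
      using symp_form_separation3[of "v + v'" m u v] V u v by auto
    moreover from w have "symp_form m v' w = 1"
      using symp_form_add_left[OF V(2,3) w(1)] by (cases "symp_form m v' w") simp_all
    moreover have "symp_form m u v' = 1" using 4 eq by simp
    ultimately show ?thesis
      using Sp_move_via[OF V w(1)] 4 that by metis
  qed
qed

text \<open>Vertex transitivity takes \<open>u\<close> to \<open>u'\<close>. The image of
  \<open>v\<close> is then corrected inside the stabilizer of \<open>u'\<close>.\<close>

lemma Sp_transitive_pairs:
  assumes uv: "u \<in> hw_vertices m" "v \<in> hw_vertices m" "u \<noteq> v"
    and uv': "u' \<in> hw_vertices m" "v' \<in> hw_vertices m" "u' \<noteq> v'"
    and eq: "symp_form m u v = symp_form m u' v'"
  obtains F where "F \<in> carrier (Sp m)" "u \<^sub>v* F = u'" "v \<^sub>v* F = v'"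
proof -
  have V: "u \<in> carrier_vec (2 * m)" "v \<in> carrier_vec (2 * m)"
    using assms by (auto simp: hw_vertices_def)
  obtain F where F: "F \<in> carrier (Sp m)" "u \<^sub>v* F = u'"
    using Sp_transitive_nonzero[OF uv(1) uv'(1)] by blast
  have "v \<^sub>v* F \<noteq> u'" using inj_onD[OF inj_row_mult_Sp[OF F(1)], of u v] F(2) V uv(3) by auto
  moreover have "symp_form m u' (v \<^sub>v* F) = symp_form m u' v'"
    using symp_form_Sp[OF F(1) V] F(2) eq by simp
  ultimately obtain G where "G \<in> carrier (Sp m)" "u' \<^sub>v* G = u'" "v \<^sub>v* F \<^sub>v* G = v'"
    using Sp_transitive_pairs_fixed[OF uv'(1) hw_vertices_Sp[OF F(1) uv(2)] _ uv'(2)] uv'(3) by blast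
  then show thesis
    using F V that[of "F * G"] by (simp add: Sp_mult_closed row_mult_Sp_mult)
qed

lemma transitive_Sp_vertices: "transitive_right_action (Sp m) (hw_vertices m) row_mult"
proof (rule transitive_right_actionI[OF group_Sp])
  show "\<exists>F\<in>carrier (Sp m). u \<^sub>v* F = v" if "u \<in> hw_vertices m" "v \<in> hw_vertices m" for u v
    using Sp_transitive_nonzero[OF that] by blast
qed (use hw_vertices_Sp in \<open>auto simp: row_mult_Sp_mult hw_vertices_def\<close>)

text \<open>Treats edges (\<open>c = 0\<close>) and non-edges (\<open>c = 1\<close>) together;
  unordered pairs are matched by choosing an order on each. For m = 1 and \<open>c = 0\<close> the
  set \<open>E\<close> is empty.\<close>

lemma transitive_Sp_pairs:
  fixes m c
  defines "E \<equiv> {{u, v} | u v. u \<in> hw_vertices m \<and> v \<in> hw_vertices m \<and> u \<noteq> v \<and> symp_form m u v = c}"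
  shows "transitive_right_action (Sp m) E row_mult_set"
proof (rule transitive_right_actionI[OF group_Sp])
  have V: "u \<in> carrier_vec (2 * m)" if "u \<in> hw_vertices m" for u
    using that by (simp add: hw_vertices_def)
  fix e F assume e: "e \<in> E" and F: "F \<in> carrier (Sp m)"
  then obtain u v where uv: "e = {u, v}" "u \<in> hw_vertices m" "v \<in> hw_vertices m" "u \<noteq> v" "symp_form m u v = c"
    by (auto simp: E_def)
  then have "u \<^sub>v* F \<noteq> v \<^sub>v* F"
    using inj_onD[OF inj_row_mult_Sp[OF F], of u v] V by auto
  moreover have "row_mult_set e F = {u \<^sub>v* F, v \<^sub>v* F}" by (simp add: uv row_mult_set_def)
  ultimately show "row_mult_set e F \<in> E"
    using hw_vertices_Sp[OF F] symp_form_Sp[OF F] uv V unfolding E_def by blast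
  fix G assume G: "G \<in> carrier (Sp m)"
  show "row_mult_set e (F \<otimes>\<^bsub>Sp m\<^esub> G) = row_mult_set (row_mult_set e F) G"
    using row_mult_Sp_mult[OF V[OF uv(2)] F G] row_mult_Sp_mult[OF V[OF uv(3)] F G] uv(1)
    by (simp add: row_mult_set_def)
next
  fix e assume "e \<in> E"
  then show "row_mult_set e \<one>\<^bsub>Sp m\<^esub> = e"
    by (auto simp: E_def row_mult_set_def hw_vertices_def)
next
  fix e e' assume "e \<in> E" "e' \<in> E"
  then obtain u v u' v' where uv: "e = {u, v}" "u \<in> hw_vertices m" "v \<in> hw_vertices m" "u \<noteq> v"
      "e' = {u', v'}" "u' \<in> hw_vertices m" "v' \<in> hw_vertices m" "u' \<noteq> v'"
      "symp_form m u v = symp_form m u' v'"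
    by (auto simp: E_def)
  then obtain F where "F \<in> carrier (Sp m)" "u \<^sub>v* F = u'" "v \<^sub>v* F = v'"
    using Sp_transitive_pairs[OF uv(2-4,6-9)] by blast
  then show "\<exists>F\<in>carrier (Sp m). row_mult_set e F = e'"
    by (intro bexI[of _ F]) (auto simp: uv row_mult_set_def)
qed


section \<open>Commutation of Pauli matrices\<close>

lemma kron_carrier:
  "A \<in> carrier_mat a b \<Longrightarrow> B \<in> carrier_mat c d \<Longrightarrow> kron A B \<in> carrier_mat (a * c) (b * d)"
  by (auto simp: kron_def)

lemma kron_index:
  assumes "A \<in> carrier_mat a b" "B \<in> carrier_mat c d" "i < a * c" "j < b * d"
  shows "kron A B $$ (i, j) = A $$ (i div c, j div d) * B $$ (i mod c, j mod d)"
  using assms by (auto simp: kron_def)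

text \<open>The mixed-product rule. The summation index below b q corresponds to its quotient and
  remainder modulo q, and the resulting double sum factors into the two matrix products.\<close>

lemma kron_mult:
  fixes A B C D :: "'a :: comm_semiring_0 mat"
  assumes A: "A \<in> carrier_mat a b" and B: "B \<in> carrier_mat p q"
    and C: "C \<in> carrier_mat b c" and D: "D \<in> carrier_mat q r"
  shows "kron A B * kron C D = kron (A * C) (B * D)"
proof (rule eq_matI)
  note AB = kron_carrier[OF A B] and CD = kron_carrier[OF C D]
  have AC: "A * C \<in> carrier_mat a c" and BD: "B * D \<in> carrier_mat p r"
    using assms by auto
  note R = kron_carrier[OF AC BD]
  show "dim_row (kron A B * kron C D) = dim_row (kron (A * C) (B * D))"
    "dim_col (kron A B * kron C D) = dim_col (kron (A * C) (B * D))"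
    using AB CD R by auto
  fix i j assume "i < dim_row (kron (A * C) (B * D))" "j < dim_col (kron (A * C) (B * D))"
  then have i: "i < a * p" and j: "j < c * r" using R by auto
  from i j have "0 < p" "0 < r" by (auto intro!: gr0I)
  with i j have ij: "i div p < a" "i mod p < p" "j div r < c" "j mod r < r"
    by (auto simp: less_mult_imp_div_less)
  have index: "(M * N) $$ (k, l) = (\<Sum>x<n. M $$ (k, x) * N $$ (x, l))"
    if "M \<in> carrier_mat k' n" "N \<in> carrier_mat n l'" "k < k'" "l < l'"
    for M N :: "'a mat" and k l k' l' n
    using that by (auto simp: scalar_prod_def atLeast0LessThan)
  have "(kron A B * kron C D) $$ (i, j)
    = (\<Sum>x<b * q. (A $$ (i div p, x div q) * C $$ (x div q, j div r))
        * (B $$ (i mod p, x mod q) * D $$ (x mod q, j mod r)))"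
    unfolding index[OF AB CD i j]
    by (intro sum.cong) (auto simp: kron_index[OF A B i] kron_index[OF C D _ j] ac_simps)
  also have "\<dots> = (\<Sum>(x, y)\<in>{..<b} \<times> {..<q}. (A $$ (i div p, x) * C $$ (x, j div r))
        * (B $$ (i mod p, y) * D $$ (y, j mod r)))"
  proof (rule sum.reindex_bij_witness[of _ "\<lambda>(x, y). x * q + y" "\<lambda>x. (x div q, x mod q)"])
    fix z assume "z \<in> {..<b} \<times> {..<q}"
    then obtain x y where z: "z = (x, y)" "x < b" "y < q" by auto
    have "x * q + y < Suc x * q" using z by simp
    also have "\<dots> \<le> b * q" using z by (intro mult_le_mono1) simp
    finally show "(case z of (x, y) \<Rightarrow> x * q + y) \<in> {..<b * q}" using z by simp
  qed (auto simp: less_mult_imp_div_less intro!: mod_less_divisor gr0I)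
  also have "\<dots> = (A * C) $$ (i div p, j div r) * (B * D) $$ (i mod p, j mod r)"
    unfolding index[OF A C ij(1,3)] index[OF B D ij(2,4)] sum_product sum.cartesian_product ..
  finally show "(kron A B * kron C D) $$ (i, j) = kron (A * C) (B * D) $$ (i, j)"
    using kron_index[OF AC BD i j] by simp
qed

lemma kron_smult:
  fixes A B :: "'a :: comm_semiring_0 mat"
  assumes "A \<in> carrier_mat a b" "B \<in> carrier_mat p q"
  shows "kron (s \<cdot>\<^sub>m A) (t \<cdot>\<^sub>m B) = (s * t) \<cdot>\<^sub>m kron A B"
proof (rule eq_matI)
  fix i j assume "i < dim_row ((s * t) \<cdot>\<^sub>m kron A B)" "j < dim_col ((s * t) \<cdot>\<^sub>m kron A B)"
  then have i: "i < a * p" and j: "j < b * q" using kron_carrier[OF assms] by auto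
  from i j have "0 < p" "0 < q" by (auto intro!: gr0I)
  with i j have "i div p < a" "i mod p < p" "j div q < b" "j mod q < q"
    by (auto simp: less_mult_imp_div_less)
  then show "kron (s \<cdot>\<^sub>m A) (t \<cdot>\<^sub>m B) $$ (i, j) = ((s * t) \<cdot>\<^sub>m kron A B) $$ (i, j)"
    using assms i j kron_carrier[OF assms]
    by (auto simp: kron_index[of _ a b _ p q] ac_simps)
qed (use assms in \<open>auto simp: kron_def\<close>)

lemma nonzero_mat_entry:
  assumes "M \<in> carrier_mat a b" "M \<noteq> 0\<^sub>m a b"
  obtains i j where "i < a" "j < b" "M $$ (i, j) \<noteq> 0"
proof (rule ccontr)
  assume "\<not> thesis"
  then have "M = 0\<^sub>m a b" using assms(1) that by (intro eq_matI) auto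
  with assms(2) show False by contradiction
qed

text \<open>A nonzero entry of \<open>A\<close> times a nonzero entry of \<open>B\<close> occurs as
  an entry of the product. Nonvanishing is what later allows a sign to be read off from an equation
  between multiples of one matrix.\<close>

lemma kron_nonzero:
  fixes A B :: "'a :: idom mat"
  assumes A: "A \<in> carrier_mat a b" "A \<noteq> 0\<^sub>m a b" and B: "B \<in> carrier_mat c d" "B \<noteq> 0\<^sub>m c d"
  shows "kron A B \<noteq> 0\<^sub>m (a * c) (b * d)"
proof
  assume zero: "kron A B = 0\<^sub>m (a * c) (b * d)"
  obtain i j where ij: "i < a" "j < b" "A $$ (i, j) \<noteq> 0"
    by (rule nonzero_mat_entry[OF A])
  obtain k l where kl: "k < c" "l < d" "B $$ (k, l) \<noteq> 0"
    by (rule nonzero_mat_entry[OF B])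
  have lt: "x * n + y < m * n" if "x < m" "y < n" for x y m n :: nat
  proof -
    have "x * n + y < Suc x * n" using that by simp
    also have "\<dots> \<le> m * n" using that by (intro mult_le_mono1) simp
    finally show ?thesis .
  qed
  have "kron A B $$ (i * c + k, j * d + l) = A $$ (i, j) * B $$ (k, l)"
    using ij kl by (subst kron_index[OF A(1) B(1)]) (auto intro: lt)
  with zero ij kl show False by (auto simp: lt)
qed

text \<open>The fold inside \<open>pauli_E\<close>, with arbitrary factors and an arbitrary index
  list so that induction on the list is possible.\<close>

definition kron_prod :: "('b \<Rightarrow> 'a :: comm_ring_1 mat) \<Rightarrow> 'b list \<Rightarrow> 'a mat" where
  "kron_prod M ks = foldr kron (map M ks) (1\<^sub>m 1)"

lemma kron_prod_simps [simp]:
  "kron_prod M [] = 1\<^sub>m 1" "kron_prod M (k # ks) = kron (M k) (kron_prod M ks)"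
  by (simp_all add: kron_prod_def)

lemma kron_prod_carrier:
  assumes "\<And>k. M k \<in> carrier_mat 2 2"
  shows "kron_prod M ks \<in> carrier_mat (2 ^ length ks) (2 ^ length ks)"
  using assms by (induction ks) (auto intro: kron_carrier)

lemma kron_prod_mult:
  assumes "\<And>k. M k \<in> carrier_mat 2 2" "\<And>k. N k \<in> carrier_mat 2 2"
  shows "kron_prod M ks * kron_prod N ks = kron_prod (\<lambda>k. M k * N k) ks"
  by (induction ks)
    (simp_all add: kron_mult[OF assms(1) kron_prod_carrier[of M, OF assms(1)] assms(2)
        kron_prod_carrier[of N, OF assms(2)]])

lemma kron_prod_smult:
  assumes "\<And>k. M k \<in> carrier_mat 2 2"
  shows "kron_prod (\<lambda>k. s k \<cdot>\<^sub>m M k) ks = (\<Prod>k\<leftarrow>ks. s k) \<cdot>\<^sub>m kron_prod M ks"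
  by (induction ks)
    (simp_all add: kron_smult[OF assms kron_prod_carrier[of M, OF assms]], auto)

lemma kron_prod_nonzero:
  fixes M :: "'b \<Rightarrow> 'a :: idom mat"
  assumes M: "\<And>k. M k \<in> carrier_mat 2 2" "\<And>k. M k \<noteq> 0\<^sub>m 2 2"
  shows "kron_prod M ks \<noteq> 0\<^sub>m (2 ^ length ks) (2 ^ length ks)"
proof (induction ks)
  case Nil
  have "(1\<^sub>m 1 :: 'a mat) $$ (0, 0) \<noteq> 0\<^sub>m 1 1 $$ (0, 0)" by simp
  then show ?case by (metis kron_prod_simps(1) list.size(3) power_0)
next
  case (Cons k ks)
  then show ?case
    using kron_nonzero[OF M(1,2) kron_prod_carrier[of M, OF M(1)], of ks k] by simp
qed

section \<open>A single tensor factor\<close>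

definition pauli_XZ :: "bit \<Rightarrow> bit \<Rightarrow> complex mat" where
  "pauli_XZ a b = pauli_X ^\<^sub>m of_bit a * pauli_Z ^\<^sub>m of_bit b"

definition bit_sign :: "bit \<Rightarrow> complex" where
  "bit_sign b = (if b = 0 then 1 else -1)"

lemma bit_sign_add: "bit_sign (a + b) = bit_sign a * bit_sign b"
  by (cases a; cases b) (simp_all add: bit_sign_def)

lemma bit_sign_sum: "(\<Prod>k\<leftarrow>ks. bit_sign (f k)) = bit_sign (\<Sum>k\<leftarrow>ks. f k)"
  by (induction ks) (simp_all add: bit_sign_add del: add_bit_eq_xor, simp add: bit_sign_def)

text \<open>The power of X selects the diagonal or the antidiagonal, and the power of Z puts its
  sign on column 1. With explicit entries, the facts about one factor become finite checks over
  bits.\<close>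

lemma pauli_XZ_eq:
  "pauli_XZ a b = mat 2 2 (\<lambda>(i, j). if (i \<noteq> j) = (a = 1) then if j = 1 then bit_sign b else 1 else 0)"
proof -
  have X: "pauli_X \<in> carrier_mat 2 2" and Z: "pauli_Z \<in> carrier_mat 2 2"
    by (auto simp: pauli_X_def pauli_Z_def mat_of_rows_list_def)
  have "pauli_XZ a b = (if a = 1 then pauli_X else 1\<^sub>m 2) * (if b = 1 then pauli_Z else 1\<^sub>m 2)"
    using X Z by (cases a; cases b) (simp_all add: pauli_XZ_def)
  also have "\<dots> = mat 2 2 (\<lambda>(i, j). if (i \<noteq> j) = (a = 1) then if j = 1 then bit_sign b else 1 else 0)"
    by (rule eq_matI; cases a; cases b)
      (auto simp: pauli_X_def pauli_Z_def mat_of_rows_list_def scalar_prod_def bit_sign_def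
        numeral_2_eq_2 less_Suc_eq)
  finally show ?thesis .
qed

lemma pauli_XZ_carrier: "pauli_XZ a b \<in> carrier_mat 2 2"
  by (simp add: pauli_XZ_eq)

lemma pauli_XZ_commutation:
  "pauli_XZ a b * pauli_XZ c d = bit_sign (a * d + b * c) \<cdot>\<^sub>m (pauli_XZ c d * pauli_XZ a b)"
  by (rule eq_matI; cases a; cases b; cases c; cases d)
    (auto simp: pauli_XZ_eq scalar_prod_def bit_sign_def numeral_2_eq_2 less_Suc_eq)

lemma pauli_XZ_mult_nonzero: "pauli_XZ a b * pauli_XZ c d \<noteq> 0\<^sub>m 2 2"
proof
  assume "pauli_XZ a b * pauli_XZ c d = 0\<^sub>m 2 2"
  \<comment> \<open>The first row suffices: these products have exactly one nonzero entry in each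
    row.\<close>
  then have "(pauli_XZ a b * pauli_XZ c d) $$ (0, 0) = 0" "(pauli_XZ a b * pauli_XZ c d) $$ (0, 1) = 0"
    by simp_all
  then show False
    by (cases a; cases b; cases c; cases d)
      (auto simp: pauli_XZ_eq scalar_prod_def bit_sign_def numeral_2_eq_2)
qed

section \<open>Commutation and the symplectic form\<close>

text \<open>The signs of the single factors multiply to (-1)^(a.d + b.c), while the powers of the
  imaginary unit contribute the same nonzero scalar to both orders. The product without scalars has
  a nonzero entry, and comparing there forces the sign to be 1 when the matrices commute.\<close>

lemma pauli_E_commute_iff:
  assumes "a \<in> carrier_vec m" "b \<in> carrier_vec m" "c \<in> carrier_vec m" "d \<in> carrier_vec m"
  shows "pauli_E m a b * pauli_E m c d = pauli_E m c d * pauli_E m a b \<longleftrightarrow> a \<bullet> d + b \<bullet> c = 0"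
proof -
  let ?P = "\<lambda>k. pauli_XZ (a $ k) (b $ k)" and ?Q = "\<lambda>k. pauli_XZ (c $ k) (d $ k)"
  let ?K = "\<lambda>M. kron_prod M [0..<m]"
  let ?M = "carrier_mat (2 ^ m) (2 ^ m) :: complex mat set"
  have c: "?K ?P \<in> ?M" "?K ?Q \<in> ?M"
    using kron_prod_carrier[of ?P "[0..<m]"] kron_prod_carrier[of ?Q "[0..<m]"]
    by (simp_all add: pauli_XZ_carrier)
  define r where "r = \<i> ^ (\<Sum>k<m. of_bit (a $ k) * of_bit (b $ k))"
  define s where "s = \<i> ^ (\<Sum>k<m. of_bit (c $ k) * of_bit (d $ k))"
  have rs: "r \<noteq> 0" "s \<noteq> 0" "pauli_E m a b = r \<cdot>\<^sub>m ?K ?P" "pauli_E m c d = s \<cdot>\<^sub>m ?K ?Q"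
    by (simp_all only: r_def s_def pauli_E_def kron_prod_def pauli_XZ_def power_not_zero complex_i_not_zero not_False_eq_True)
  have carrier: "?Q k * ?P k \<in> carrier_mat 2 2" for k
    by (rule mult_carrier_mat[OF pauli_XZ_carrier pauli_XZ_carrier])
  have sum: "(\<Sum>k\<leftarrow>[0..<m]. a $ k * d $ k + b $ k * c $ k) = a \<bullet> d + b \<bullet> c"
    using assms
    by (simp add: interv_sum_list_conv_sum_set_nat scalar_prod_def sum.distrib
        del: add_bit_eq_xor mult_bit_eq_and)
  have "?K ?P * ?K ?Q = ?K (\<lambda>k. bit_sign (a $ k * d $ k + b $ k * c $ k) \<cdot>\<^sub>m (?Q k * ?P k))"
    by (subst kron_prod_mult) (simp_all only: pauli_XZ_carrier pauli_XZ_commutation[symmetric])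
  also have "\<dots> = bit_sign (a \<bullet> d + b \<bullet> c) \<cdot>\<^sub>m ?K (\<lambda>k. ?Q k * ?P k)"
    by (simp only: kron_prod_smult[of "\<lambda>k. ?Q k * ?P k", OF carrier] bit_sign_sum sum)
  also have "?K (\<lambda>k. ?Q k * ?P k) = ?K ?Q * ?K ?P"
    by (simp add: kron_prod_mult pauli_XZ_carrier)
  finally have comm: "?K ?P * ?K ?Q = bit_sign (a \<bullet> d + b \<bullet> c) \<cdot>\<^sub>m (?K ?Q * ?K ?P)" .
  have "?K ?Q * ?K ?P \<noteq> 0\<^sub>m (2 ^ m) (2 ^ m)"
    using kron_prod_nonzero[of "\<lambda>k. ?Q k * ?P k" "[0..<m]", OF carrier pauli_XZ_mult_nonzero]
    by (simp add: kron_prod_mult pauli_XZ_carrier)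
  then obtain i j where ij: "i < 2 ^ m" "j < 2 ^ m" "(?K ?Q * ?K ?P) $$ (i, j) \<noteq> 0"
    by (rule nonzero_mat_entry[OF mult_carrier_mat[OF c(2,1)]])
  have smult_smult: "x \<cdot>\<^sub>m (y \<cdot>\<^sub>m M) = (x * y) \<cdot>\<^sub>m M" for x y and M :: "complex mat"
    by (rule eq_matI) auto
  have PQ: "pauli_E m a b * pauli_E m c d = (r * s * bit_sign (a \<bullet> d + b \<bullet> c)) \<cdot>\<^sub>m (?K ?Q * ?K ?P)"
    using c rs(3,4) by (simp add: comm mult_smult_distrib[of _ "2 ^ m" "2 ^ m"] mult_smult_assoc_mat[of _ "2 ^ m" "2 ^ m"] smult_smult ac_simps)
  have QP: "pauli_E m c d * pauli_E m a b = (r * s) \<cdot>\<^sub>m (?K ?Q * ?K ?P)"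
    using c rs(3,4) by (simp add: mult_smult_distrib[of _ "2 ^ m" "2 ^ m"] mult_smult_assoc_mat[of _ "2 ^ m" "2 ^ m"] smult_smult ac_simps)
  show ?thesis
  proof
    assume "pauli_E m a b * pauli_E m c d = pauli_E m c d * pauli_E m a b"
    then have "((r * s * bit_sign (a \<bullet> d + b \<bullet> c)) \<cdot>\<^sub>m (?K ?Q * ?K ?P)) $$ (i, j)
      = ((r * s) \<cdot>\<^sub>m (?K ?Q * ?K ?P)) $$ (i, j)"
      by (simp only: PQ QP)
    moreover have "(t \<cdot>\<^sub>m (?K ?Q * ?K ?P)) $$ (i, j) = t * (?K ?Q * ?K ?P) $$ (i, j)" for t
      using ij c by (intro index_smult_mat) auto
    ultimately have "bit_sign (a \<bullet> d + b \<bullet> c) = 1" using rs ij by simp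
    then show "a \<bullet> d + b \<bullet> c = 0" by (auto simp: bit_sign_def split: if_splits)
  next
    assume "a \<bullet> d + b \<bullet> c = 0"
    then show "pauli_E m a b * pauli_E m c d = pauli_E m c d * pauli_E m a b"
      unfolding PQ QP by (simp add: bit_sign_def)
  qed
qed

lemma hw_commute_iff:
  assumes "u \<in> carrier_vec (2 * m)" "v \<in> carrier_vec (2 * m)"
  shows "hw_commute m u v \<longleftrightarrow> symp_form m u v = 0"
proof -
  have "symp_form m (vec_first u m @\<^sub>v vec_last u m) (vec_first v m @\<^sub>v vec_last v m)
    = vec_first u m \<bullet> vec_last v m + vec_last u m \<bullet> vec_first v m"
    by (rule symp_form_append) auto
  then show ?thesis
    using assms
    by (simp add: hw_commute_def Let_def pauli_E_commute_iff mult_2 del: add_bit_eq_xor)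
qed

lemma hw_edges_eq:
  "hw_edges m = {{u, v} | u v. u \<in> hw_vertices m \<and> v \<in> hw_vertices m \<and> u \<noteq> v \<and> symp_form m u v = 0}"
  unfolding hw_edges_def
  by (intro Collect_cong ex_cong1 conj_cong refl) (auto simp: hw_vertices_def hw_commute_iff)

lemma hw_nonedges_eq:
  "hw_nonedges m = {{u, v} | u v. u \<in> hw_vertices m \<and> v \<in> hw_vertices m \<and> u \<noteq> v \<and> symp_form m u v = 1}"
  unfolding hw_nonedges_def
  by (intro Collect_cong ex_cong1 conj_cong refl) (auto simp: hw_vertices_def hw_commute_iff)


section \<open>The Kerdock symmetries\<close>

lemma Omega_Sp: "Omega m \<in> carrier (Sp m)"
  unfolding Sp_iff_preserves_symp_form[OF Omega_carrier]
proof safe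
  fix u v :: "bit vec" assume uv: "u \<in> carrier_vec (2 * m)" "v \<in> carrier_vec (2 * m)"
  then show "symp_form m (u \<^sub>v* Omega m) (v \<^sub>v* Omega m) = symp_form m u v"
    by (elim hw_vector_cases) (simp add: row_mult_Omega symp_form_append add.commute del: add_bit_eq_xor)
qed

lemma L_mat_carrier:
  assumes "Q \<in> carrier_mat m m" "det Q \<noteq> 0"
  shows "L_mat Q \<in> carrier_mat (2 * m) (2 * m)"
  using assms inv_mat(1)[OF assms] unfolding L_mat_def mult_2 by (intro four_block_carrier_mat) auto

lemma row_mult_L_mat:
  assumes Q: "Q \<in> carrier_mat m m" "det Q \<noteq> 0" and "a \<in> carrier_vec m" "b \<in> carrier_vec m"
  shows "(a @\<^sub>v b) \<^sub>v* L_mat Q = (a \<^sub>v* Q) @\<^sub>v (inv_mat Q *\<^sub>v b)"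
  unfolding L_mat_def using assms inv_mat(1)[OF Q]
  by (subst row_mult_four_block[of _ m m _ m _ m]) (auto simp: row_mult_def)

text \<open>The second half is transformed contragrediently to the first: the pairing of xQ with
  Q^{-1} y is that of x with y. So each of the two summands of the form is preserved.\<close>

lemma L_mat_Sp:
  assumes Q: "Q \<in> carrier_mat m m" "det Q \<noteq> 0"
  shows "L_mat Q \<in> carrier (Sp m)"
  unfolding Sp_iff_preserves_symp_form[OF L_mat_carrier[OF Q]]
proof safe
  have cancel: "(x \<^sub>v* Q) \<bullet> (inv_mat Q *\<^sub>v y) = x \<bullet> y" if "x \<in> carrier_vec m" "y \<in> carrier_vec m" for x y
    using row_mult_scalar_prod[OF row_mult_carrier[OF Q(1)] inv_mat(1)[OF Q] that(2), of x]
      row_mult_inv_mat[OF Q that(1)] by simp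
  fix u v :: "bit vec" assume "u \<in> carrier_vec (2 * m)" "v \<in> carrier_vec (2 * m)"
  then obtain a b c d where uv: "u = a @\<^sub>v b" "v = c @\<^sub>v d"
    and abcd: "a \<in> carrier_vec m" "b \<in> carrier_vec m" "c \<in> carrier_vec m" "d \<in> carrier_vec m"
    by (metis hw_vector_cases)
  have V: "a \<^sub>v* Q \<in> carrier_vec m" "c \<^sub>v* Q \<in> carrier_vec m"
    "inv_mat Q *\<^sub>v b \<in> carrier_vec m" "inv_mat Q *\<^sub>v d \<in> carrier_vec m"
    using row_mult_carrier[OF Q(1)] inv_mat(1)[OF Q] abcd by auto
  have "symp_form m (u \<^sub>v* L_mat Q) (v \<^sub>v* L_mat Q)
    = (a \<^sub>v* Q) \<bullet> (inv_mat Q *\<^sub>v d) + (inv_mat Q *\<^sub>v b) \<bullet> (c \<^sub>v* Q)"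
    using abcd V by (simp add: uv row_mult_L_mat[OF Q] symp_form_append del: add_bit_eq_xor)
  also have "\<dots> = a \<bullet> d + b \<bullet> c"
    unfolding comm_scalar_prod[OF V(3,2)] cancel[OF abcd(1,4)] cancel[OF abcd(3,2)]
      comm_scalar_prod[OF abcd(3,2)] ..
  also have "\<dots> = symp_form m u v"
    using abcd by (simp add: uv symp_form_append del: add_bit_eq_xor)
  finally show "symp_form m (u \<^sub>v* L_mat Q) (v \<^sub>v* L_mat Q) = symp_form m u v" .
qed

lemma row_mult_T_mat:
  assumes P: "P \<in> carrier_mat m m" and ab: "a \<in> carrier_vec m" "b \<in> carrier_vec m"
  shows "(a @\<^sub>v b) \<^sub>v* T_mat P = a @\<^sub>v (a \<^sub>v* P + b)"
proof -
  have "0\<^sub>m m m *\<^sub>v b = 0\<^sub>v m" using ab by (intro eq_vecI) auto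
  then show ?thesis
    unfolding T_mat_def using assms
    by (subst row_mult_four_block[of _ m m _ m _ m]) (auto simp: row_mult_def)
qed

text \<open>By symmetry the two new terms a.(cP) and (aP).c agree and cancel in characteristic 2.
  Symmetry of \<open>P\<close> is phrased through its bilinear form, since for the Kerdock matrices
  it comes from the trace form.\<close>

lemma T_mat_Sp:
  assumes P: "P \<in> carrier_mat m m"
    and sym: "\<And>x y. x \<in> carrier_vec m \<Longrightarrow> y \<in> carrier_vec m \<Longrightarrow> (x \<^sub>v* P) \<bullet> y = (y \<^sub>v* P) \<bullet> x"
  shows "T_mat P \<in> carrier (Sp m)"
proof -
  have T: "T_mat P \<in> carrier_mat (2 * m) (2 * m)"
    using P unfolding T_mat_def mult_2 by (intro four_block_carrier_mat) auto
  show ?thesis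
    unfolding Sp_iff_preserves_symp_form[OF T]
  proof safe
    fix u v :: "bit vec" assume "u \<in> carrier_vec (2 * m)" "v \<in> carrier_vec (2 * m)"
    then obtain a b c d where uv: "u = a @\<^sub>v b" "v = c @\<^sub>v d"
      and abcd: "a \<in> carrier_vec m" "b \<in> carrier_vec m" "c \<in> carrier_vec m" "d \<in> carrier_vec m"
      by (metis hw_vector_cases)
    have V: "a \<^sub>v* P \<in> carrier_vec m" "c \<^sub>v* P \<in> carrier_vec m"
      using row_mult_carrier[OF P] by auto
    have "symp_form m (u \<^sub>v* T_mat P) (v \<^sub>v* T_mat P) = a \<bullet> (c \<^sub>v* P + d) + (a \<^sub>v* P + b) \<bullet> c"
      using abcd V by (simp add: uv row_mult_T_mat[OF P] symp_form_append del: add_bit_eq_xor)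
    also have "\<dots> = (a \<bullet> (c \<^sub>v* P) + a \<bullet> d) + ((a \<^sub>v* P) \<bullet> c + b \<bullet> c)"
      using abcd V by (simp only: scalar_prod_add_distrib add_scalar_prod_distrib)
    also have "(a \<^sub>v* P) \<bullet> c = a \<bullet> (c \<^sub>v* P)"
      using sym[OF abcd(1,3)] comm_scalar_prod[OF abcd(1) V(2)] by simp
    also have "(a \<bullet> (c \<^sub>v* P) + a \<bullet> d) + (a \<bullet> (c \<^sub>v* P) + b \<bullet> c)
      = (a \<bullet> (c \<^sub>v* P) + a \<bullet> (c \<^sub>v* P)) + (a \<bullet> d + b \<bullet> c)"
      by (simp only: add_ac)
    also have "\<dots> = symp_form m u v"
      using abcd by (simp add: uv symp_form_append bit_add_self del: add_bit_eq_xor)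
    finally show "symp_form m (u \<^sub>v* T_mat P) (v \<^sub>v* T_mat P) = symp_form m u v" .
  qed
qed

section \<open>Counting roots of the trace polynomial\<close>

text \<open>The bound on the number of roots over the quotient by \<open>p\<close>, phrased with
  pairwise incongruent representatives so that no quotient ring has to be built. Division by x - a
  at a root a leaves a remainder divisible by \<open>p\<close>, so by primality every other root is
  a root of the quotient \<open>q\<close>.\<close>

lemma card_roots_mod_prime:
  fixes p :: "'a :: idom"
  assumes p: "prime_elem p" and "\<not> p dvd lead_coeff f"
    and "\<And>x. x \<in> S \<Longrightarrow> p dvd poly f x"
    and "\<And>x y. x \<in> S \<Longrightarrow> y \<in> S \<Longrightarrow> p dvd x - y \<Longrightarrow> x = y"
  shows "finite S \<and> card S \<le> degree f"
  using assms(2-)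
proof (induction "degree f" arbitrary: f S)
  case 0
  obtain c where "f = [:c:]" using 0(1) degree_eq_zeroE by metis
  with 0 have "S = {}" by auto
  then show ?case by simp
next
  case (Suc n)
  show ?case
  proof (cases "S = {}")
    case False
    then obtain a where a: "a \<in> S" by blast
    define q where "q = synthetic_div f a"
    have deg: "degree q = n" using Suc(2) by (simp add: q_def degree_synthetic_div)
    \<comment> \<open>Compares top coefficients in the division identity: \<open>q\<close> has
      degree \<open>n\<close>, so \<open>smult a q\<close> contributes nothing in degree
      \<open>Suc n\<close>.\<close>
    have "coeff (f + smult a q) (Suc n) = coeff (pCons (poly f a) q) (Suc n)"
      by (simp only: q_def synthetic_div_correct)
    then have "lead_coeff q = lead_coeff f"
      using deg by (simp add: Suc(2)[symmetric] coeff_eq_0)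
    moreover have "p dvd poly q x" if x: "x \<in> S - {a}" for x
    proof -
      have "poly f x = poly ([:- a, 1:] * q + [:poly f a:]) x"
        by (simp only: q_def synthetic_div_correct')
      then have "poly f x = (x - a) * poly q x + poly f a" by (simp add: algebra_simps)
      then have "p dvd (x - a) * poly q x"
        using Suc(4)[of x] Suc(4)[OF a] x by (metis DiffD1 dvd_add_left_iff)
      then show ?thesis
        using p x a Suc(5)[of x a] by (auto simp: prime_elem_dvd_mult_iff)
    qed
    ultimately have "finite (S - {a}) \<and> card (S - {a}) \<le> degree q"
      using Suc(3,5) deg by (intro Suc(1)) auto
    then show ?thesis
      using deg Suc(2) a by (auto simp: card_Diff_singleton)
  qed simp
qed

lemma irreducible_degree_pos: "irreducible (p :: 'a :: field poly) \<Longrightarrow> degree p > 0"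
  by (metis irreducible_def is_unit_iff_degree gr0I)

text \<open>The trace polynomial has degree \<open>2\<^sup>m\<^sup>-\<^sup>1\<close>, hence fewer roots than the field has elements.\<close>

lemma trace_nonzero:
  assumes p: "irreducible p"
  obtains x where "x \<in> carrier_vec (degree p)" "fld_trace p x \<noteq> 0"
proof -
  define m where "m = degree p"
  have m: "m > 0" using irreducible_degree_pos[OF p] by (simp add: m_def)
  \<comment> \<open>The trace as a polynomial in a new variable with binary polynomials as
    coefficients. Its value at a representative is the trace before reduction modulo
    \<open>p\<close>.\<close>
  define f :: "bit poly poly" where "f = (\<Sum>i<m. monom 1 (2 ^ i))"
  have poly_f: "poly f g = (\<Sum>i<m. g ^ (2 ^ i))" for g
    by (simp add: f_def poly_sum poly_monom)
  have "coeff f (2 ^ (m - 1)) = (\<Sum>i<m. if i = m - 1 then 1 else 0)"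
    unfolding f_def coeff_sum by (intro sum.cong) auto
  also have "\<dots> = 1" using m by (subst sum.delta) auto
  finally have coeff_f: "coeff f (2 ^ (m - 1)) = 1" .
  have "degree f \<le> 2 ^ (m - 1)"
    unfolding f_def
  proof (rule degree_sum_le)
    fix i assume "i \<in> {..<m}"
    then have "(2::nat) ^ i \<le> 2 ^ (m - 1)" by (intro power_increasing) auto
    then show "degree (monom (1 :: bit poly) (2 ^ i)) \<le> 2 ^ (m - 1)"
      using degree_monom_le order_trans by blast
  qed simp
  moreover from coeff_f have "2 ^ (m - 1) \<le> degree f" by (intro le_degree) simp
  ultimately have deg_f: "degree f = 2 ^ (m - 1)" by simp
  let ?S = "{g :: bit poly. degree g < m}"
  have "\<exists>g\<in>?S. \<not> p dvd poly f g"
  proof (rule ccontr)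
    assume "\<not> ?thesis"
    then have root: "p dvd poly f g" if "g \<in> ?S" for g using that by blast
    have lc: "\<not> p dvd lead_coeff f"
      using p unfolding deg_f coeff_f irreducible_def by blast
    have inj: "x = y" if "x \<in> ?S" "y \<in> ?S" "p dvd x - y" for x y
    proof -
      have "degree (x - y) < degree p" using that by (auto simp: m_def intro: degree_diff_less)
      then show ?thesis using dvd_imp_degree_le[OF that(3)] by force
    qed
    have "finite ?S \<and> card ?S \<le> degree f"
      by (rule card_roots_mod_prime[OF field_poly_irreducible_imp_prime[OF p] lc root inj])
    then have "card ?S \<le> 2 ^ (m - 1)" using deg_f by simp
    also have "\<dots> < (2 :: nat) ^ m" using m by (intro power_strict_increasing) auto
    finally show False using card_residues(2)[OF m] by simp
  qed
  then obtain g where g: "degree g < m" "\<not> p dvd poly f g" by auto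
  have "poly_of (fld_of p g) = g"
    using g m by (simp add: poly_of_fld_of m_def mod_poly_less)
  then have "[:fld_trace p (fld_of p g):] = poly f g mod p"
    using trace_const[OF p, of "fld_of p g"] by (simp add: poly_f m_def)
  also have "\<dots> \<noteq> 0" using g by (simp add: mod_eq_0_iff_dvd)
  finally have "fld_trace p (fld_of p g) \<noteq> 0" by (metis pCons_0_0)
  then show thesis using that[of "fld_of p g"] by simp
qed

section \<open>Field arithmetic on coordinate vectors\<close>

lemma fld_mult_commute: "fld_mult p x y = fld_mult p y x"
  by (simp add: fld_mult_def mult.commute)

lemma fld_mult_assoc:
  assumes "degree p > 0"
  shows "fld_mult p (fld_mult p x y) z = fld_mult p x (fld_mult p y z)"
proof -
  have "(poly_of x * poly_of y) mod p * poly_of z mod p = poly_of x * ((poly_of y * poly_of z) mod p) mod p"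
    by (simp add: mod_mult_left_eq mod_mult_right_eq mult.assoc)
  then show ?thesis
    using assms by (simp add: fld_mult_def poly_of_fld_of) (simp add: fld_of_def)
qed

lemma poly_of_eq_0_iff: "x \<in> carrier_vec n \<Longrightarrow> poly_of x = 0 \<longleftrightarrow> x = 0\<^sub>v n"
  by (auto simp: poly_eq_iff coeff_poly_of intro!: eq_vecI)

lemma fld_of_poly_of:
  assumes x: "x \<in> carrier_vec (degree p)" and p: "degree p > 0"
  shows "poly_of x mod p = poly_of x" "fld_of p (poly_of x) = x"
proof -
  have "degree (poly_of x) < degree p"
    using x p by (intro degree_lessI) (auto simp: coeff_poly_of)
  then show *: "poly_of x mod p = poly_of x" by (rule mod_poly_less)
  show "fld_of p (poly_of x) = x"
    unfolding fld_of_def * using x by (intro eq_vecI) (auto simp: coeff_poly_of)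
qed

lemma fld_mult_one:
  assumes "x \<in> carrier_vec (degree p)" "degree p > 0"
  shows "fld_mult p (fld_of p 1) x = x"
proof -
  have "fld_mult p (fld_of p 1) x = fld_of p (1 mod p * poly_of x)"
    using assms by (simp add: fld_mult_def poly_of_fld_of)
  also have "\<dots> = fld_of p (poly_of x)"
    unfolding fld_of_def by (simp add: mod_mult_left_eq)
  finally show ?thesis using fld_of_poly_of[OF assms] by simp
qed

text \<open>An irreducible polynomial over a field is prime, and a coordinate vector stands for a
  reduced polynomial, which \<open>p\<close> divides only if it is 0.\<close>

lemma fld_mult_eq_0:
  assumes p: "irreducible p" and x: "x \<in> carrier_vec (degree p)" and y: "y \<in> carrier_vec (degree p)"
    and xy: "fld_mult p x y = 0\<^sub>v (degree p)"
  shows "x = 0\<^sub>v (degree p) \<or> y = 0\<^sub>v (degree p)"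
proof -
  note pos = irreducible_degree_pos[OF p]
  have "poly_of x * poly_of y mod p = 0"
    using xy poly_of_fld_of[OF pos, of "poly_of x * poly_of y"]
      poly_of_eq_0_iff[OF zero_carrier_vec[of "degree p"]]
    by (simp add: fld_mult_def)
  then have "p dvd poly_of x \<or> p dvd poly_of y"
    using field_poly_irreducible_imp_prime[OF p] by (auto simp: mod_eq_0_iff_dvd prime_elem_dvd_mult_iff)
  then show ?thesis
    using fld_of_poly_of(1)[OF x pos] fld_of_poly_of(1)[OF y pos] poly_of_eq_0_iff[OF x] poly_of_eq_0_iff[OF y]
    by (metis dvd_imp_mod_0)
qed

section \<open>Invertibility of multiplication, Frobenius and trace matrices\<close>

lemma det_A_mat:
  assumes p: "irreducible p" and z: "z \<in> carrier_vec (degree p)" "z \<noteq> 0\<^sub>v (degree p)"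
  shows "det (A_mat p z) \<noteq> 0"
  by (rule det_nonzeroI[OF A_mat(1)]) (use fld_mult_eq_0[OF p] z A_mat(2) in auto)

text \<open>Squaring is additive, and its kernel is trivial because the field has no zero
  divisors.\<close>

lemma det_R_mat:
  assumes p: "irreducible p"
  shows "det (R_mat p) \<noteq> 0"
  by (rule det_nonzeroI[OF R_mat(1)]) (use fld_mult_eq_0[OF p] R_mat(2) in auto)

text \<open>The inverse of the matrix of multiplication by \<open>a\<close> supplies the quotient;
  square roots come from the inverse Frobenius matrix in the same way.\<close>

lemma fld_divide:
  assumes p: "irreducible p" and a: "a \<in> carrier_vec (degree p)" "a \<noteq> 0\<^sub>v (degree p)"
    and y: "y \<in> carrier_vec (degree p)"
  obtains z where "z \<in> carrier_vec (degree p)" "fld_mult p a z = y"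
proof
  let ?z = "y \<^sub>v* inv_mat (A_mat p a)"
  show z: "?z \<in> carrier_vec (degree p)"
    by (rule row_mult_carrier[OF inv_mat(1)[OF A_mat(1) det_A_mat[OF p a]]])
  show "fld_mult p a ?z = y"
    using row_mult_inv_mat(2)[OF A_mat(1) det_A_mat[OF p a] y] A_mat(2)[OF z, of a]
    by (simp add: fld_mult_commute)
qed

lemma fld_sqrt:
  assumes p: "irreducible p" and z: "z \<in> carrier_vec (degree p)"
  obtains x where "x \<in> carrier_vec (degree p)" "fld_mult p x x = z"
proof
  let ?x = "z \<^sub>v* inv_mat (R_mat p)"
  show x: "?x \<in> carrier_vec (degree p)"
    by (rule row_mult_carrier[OF inv_mat(1)[OF R_mat(1) det_R_mat[OF p]]])
  show "fld_mult p ?x ?x = z"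
    using row_mult_inv_mat(2)[OF R_mat(1) det_R_mat[OF p] z] R_mat(2)[OF x] by simp
qed

text \<open>Nondegeneracy of the trace form: for x \<noteq> 0 the product xy takes every value, in
  particular one of nonzero trace, which contradicts xW = 0.\<close>

lemma det_W_mat:
  assumes p: "irreducible p"
  shows "det (W_mat p) \<noteq> 0"
proof (rule det_nonzeroI[OF W_mat(1)], rule ccontr)
  fix x :: "bit vec"
  assume x: "x \<in> carrier_vec (degree p)" "x \<^sub>v* W_mat p = 0\<^sub>v (degree p)" "x \<noteq> 0\<^sub>v (degree p)"
  obtain t where t: "t \<in> carrier_vec (degree p)" "fld_trace p t \<noteq> 0"
    by (rule trace_nonzero[OF p])
  obtain y where y: "y \<in> carrier_vec (degree p)" "fld_mult p x y = t"
    by (rule fld_divide[OF p x(1,3) t(1)])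
  have "fld_trace p t = (x \<^sub>v* W_mat p) \<bullet> y" using W_mat(2)[OF x(1) y(1)] y(2) by simp
  then show False using t y x by simp
qed

section \<open>The generators of the Kerdock groups\<close>

lemma kerdock_mat_carrier: "A_mat p x ^\<^sub>m 2 * W_mat p \<in> carrier_mat (degree p) (degree p)"
  using A_mat(1)[of p x] W_mat(1)[of p] by (metis mult_carrier_mat pow_carrier_mat)

lemma row_mult_kerdock_mat:
  assumes p: "degree p > 0" and u: "u \<in> carrier_vec (degree p)"
  shows "u \<^sub>v* (A_mat p x ^\<^sub>m 2 * W_mat p) = fld_mult p u (fld_mult p x x) \<^sub>v* W_mat p"
proof -
  let ?n = "degree p"
  have "A_mat p x ^\<^sub>m 2 = A_mat p x * A_mat p x"
    using A_mat(1)[of p x] by (simp add: numeral_2_eq_2)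
  moreover have "A_mat p x * A_mat p x \<in> carrier_mat ?n ?n"
    using A_mat(1) A_mat(1) by (rule mult_carrier_mat)
  ultimately have "u \<^sub>v* (A_mat p x ^\<^sub>m 2 * W_mat p) = u \<^sub>v* A_mat p x \<^sub>v* A_mat p x \<^sub>v* W_mat p"
    using row_mult_mult[OF u _ W_mat(1)] row_mult_mult[OF u A_mat(1) A_mat(1)] by simp
  then show ?thesis using u p by (simp add: A_mat(2) fld_mult_assoc)
qed

text \<open>The associated bilinear form is Tr(u x^2 v), which is symmetric in u and v.\<close>

lemma T_kerdock_Sp:
  assumes p: "degree p > 0"
  shows "T_mat (A_mat p x ^\<^sub>m 2 * W_mat p) \<in> carrier (Sp (degree p))"
proof (rule T_mat_Sp[OF kerdock_mat_carrier])
  fix u v :: "bit vec" assume uv: "u \<in> carrier_vec (degree p)" "v \<in> carrier_vec (degree p)"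
  let ?xx = "fld_mult p x x"
  have "(u \<^sub>v* (A_mat p x ^\<^sub>m 2 * W_mat p)) \<bullet> v = fld_trace p (fld_mult p (fld_mult p u ?xx) v)"
    if "u \<in> carrier_vec (degree p)" "v \<in> carrier_vec (degree p)" for u v
    using that p by (simp add: row_mult_kerdock_mat W_mat(2))
  moreover have "fld_mult p (fld_mult p u ?xx) v = fld_mult p (fld_mult p v ?xx) u"
    using p fld_mult_assoc fld_mult_commute by metis
  ultimately show "(u \<^sub>v* (A_mat p x ^\<^sub>m 2 * W_mat p)) \<bullet> v = (v \<^sub>v* (A_mat p x ^\<^sub>m 2 * W_mat p)) \<bullet> u"
    using uv by simp
qed

lemma det_pow_mat_nonzero:
  fixes A :: "'a :: field mat"
  assumes A: "A \<in> carrier_mat n n" "det A \<noteq> 0"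
  shows "det (A ^\<^sub>m i) \<noteq> 0"
proof (induction i)
  case (Suc i)
  then show ?case using A by (simp add: det_mult[of _ n])
qed (use A in simp)

text \<open>Ensures that \<open>generate\<close> yields a subgroup of \<open>Sp\<close>. The check
  is made for the larger generating set, from which \<open>PK_gens\<close> inherits it.\<close>

lemma PK_star_gens_Sp:
  assumes p: "irreducible p"
  shows "PK_star_gens p \<subseteq> carrier (Sp (degree p))"
proof -
  let ?n = "degree p"
  note W = inv_mat(1)[OF W_mat(1) det_W_mat[OF p]] det_inv_mat[OF W_mat(1) det_W_mat[OF p]]
  note R = inv_mat(1)[OF R_mat(1) det_R_mat[OF p]] det_inv_mat[OF R_mat(1) det_R_mat[OF p]]
  have "L_mat (inv_mat (R_mat p) ^\<^sub>m i * inv_mat (A_mat p x)) \<in> carrier (Sp ?n)"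
    if x: "x \<in> carrier_vec ?n" "x \<noteq> 0\<^sub>v ?n" for x i
  proof -
    note A = inv_mat(1)[OF A_mat(1) det_A_mat[OF p x]] det_inv_mat[OF A_mat(1) det_A_mat[OF p x]]
    note Ri = pow_carrier_mat[OF R(1)] det_pow_mat_nonzero[OF R]
    show ?thesis
      using det_mult[OF Ri(1) A(1)] A(2) Ri(2) by (intro L_mat_Sp mult_carrier_mat[OF Ri(1) A(1)]) simp
  qed
  then show ?thesis
    using Sp_mult_closed[OF Omega_Sp L_mat_Sp[OF W]] T_kerdock_Sp[OF irreducible_degree_pos[OF p]]
    by (auto simp: PK_star_gens_def PK_common_def)
qed

text \<open>The exponent \<open>i = 0\<close> gives the generators without a Frobenius factor; it is
  in range because the degree is positive.\<close>

lemma PK_gens_subset_PK_star_gens: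
  assumes p: "irreducible p"
  shows "PK_gens p \<subseteq> PK_star_gens p"
proof -
  have "\<exists>y i. L_mat (inv_mat (A_mat p x)) = L_mat (inv_mat (R_mat p) ^\<^sub>m i * inv_mat (A_mat p y)) \<and>
      y \<in> carrier_vec (degree p) - {0\<^sub>v (degree p)} \<and> i < degree p"
    if x: "x \<in> carrier_vec (degree p) - {0\<^sub>v (degree p)}" for x
  proof -
    have "inv_mat (R_mat p) ^\<^sub>m 0 * inv_mat (A_mat p x) = inv_mat (A_mat p x)"
      using inv_mat(1)[OF R_mat(1) det_R_mat[OF p]] inv_mat(1)[OF A_mat(1) det_A_mat[OF p, of x]] x
      by simp
    then show ?thesis using x irreducible_degree_pos[OF p] by metis
  qed
  then show ?thesis by (auto simp: PK_gens_def PK_star_gens_def)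
qed

section \<open>Transitivity of the Kerdock groups\<close>

lemma PK_gens_reach_base:
  assumes p: "irreducible p" and v: "v \<in> hw_vertices (degree p)"
  shows "\<exists>g\<in>generate (Sp (degree p)) (PK_gens p). v \<^sub>v* g = fld_of p 1 @\<^sub>v 0\<^sub>v (degree p)"
proof -
  let ?n = "degree p"
  let ?H = "generate (Sp ?n) (PK_gens p)"
  interpret Sp: group "Sp ?n" by (rule group_Sp)
  note pos = irreducible_degree_pos[OF p]
  have gens_Sp: "PK_gens p \<subseteq> carrier (Sp ?n)"
    using PK_gens_subset_PK_star_gens[OF p] PK_star_gens_Sp[OF p] by blast
  have H_Sp: "?H \<subseteq> carrier (Sp ?n)" by (rule Sp.generate_incl[OF gens_Sp])
  have mult: "g * h \<in> ?H" if "g \<in> ?H" "h \<in> ?H" for g h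
    using generate.eng[OF that] by simp
  have comp: "w \<^sub>v* (g * h) = w \<^sub>v* g \<^sub>v* h" if "g \<in> ?H" "h \<in> ?H" "w \<in> carrier_vec (2 * ?n)" for g h w
    using row_mult_Sp_mult that H_Sp by blast
  have reach: "\<exists>g\<in>?H. (a @\<^sub>v b) \<^sub>v* g = fld_of p 1 @\<^sub>v 0\<^sub>v ?n"
    if a: "a \<in> carrier_vec ?n" "a \<noteq> 0\<^sub>v ?n" and b: "b \<in> carrier_vec ?n" for a b
  proof -
    note W = W_mat(1) det_W_mat[OF p]
    note A = A_mat(1) det_A_mat[OF p a]
    \<comment> \<open>Solves a x^2 W = b for x: remove W, divide by a, take the square root. Adding
      this to the second half gives b + b = 0.\<close>
    have y: "b \<^sub>v* inv_mat (W_mat p) \<in> carrier_vec ?n" by (rule row_mult_carrier[OF inv_mat(1)[OF W]])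
    obtain z where z: "z \<in> carrier_vec ?n" "fld_mult p a z = b \<^sub>v* inv_mat (W_mat p)"
      by (rule fld_divide[OF p a y])
    obtain x where x: "x \<in> carrier_vec ?n" "fld_mult p x x = z"
      by (rule fld_sqrt[OF p z(1)])
    let ?T = "T_mat (A_mat p x ^\<^sub>m 2 * W_mat p)" and ?L = "L_mat (inv_mat (A_mat p a))"
    have TL: "?T \<in> ?H" "?L \<in> ?H"
      using x a by (auto intro!: generate.incl simp: PK_gens_def PK_common_def)
    have "a \<^sub>v* (A_mat p x ^\<^sub>m 2 * W_mat p) = b"
      using row_mult_kerdock_mat[OF pos a(1)] x(2) z(2) row_mult_inv_mat(2)[OF W b] by simp
    then have T: "(a @\<^sub>v b) \<^sub>v* ?T = a @\<^sub>v 0\<^sub>v ?n"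
      using row_mult_T_mat[OF kerdock_mat_carrier a(1) b] bit_vec_add_self[OF b] by simp
    \<comment> \<open>\<open>fld_of p 1\<close> is the unit of the field, so multiplication by
      \<open>a\<close> sends it to \<open>a\<close> and the generator with the inverse matrix sends
      \<open>a\<close> back.\<close>
    have "fld_of p 1 \<^sub>v* A_mat p a = a"
      using A_mat(2)[of "fld_of p 1" p a] fld_mult_one[OF a(1) pos] by simp
    then have "a \<^sub>v* inv_mat (A_mat p a) = fld_of p 1"
      using row_mult_inv_mat(1)[OF A, of "fld_of p 1"] by simp
    moreover have "inv_mat (inv_mat (A_mat p a)) *\<^sub>v 0\<^sub>v ?n = 0\<^sub>v ?n"
      using inv_mat(1)[OF inv_mat(1)[OF A] det_inv_mat[OF A]] by (intro eq_vecI) auto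
    ultimately have L: "(a @\<^sub>v 0\<^sub>v ?n) \<^sub>v* ?L = fld_of p 1 @\<^sub>v 0\<^sub>v ?n"
      using row_mult_L_mat[OF inv_mat(1)[OF A] det_inv_mat[OF A] a(1), of "0\<^sub>v ?n"] by simp
    have "a @\<^sub>v b \<in> carrier_vec (2 * ?n)" using a b by (simp add: mult_2)
    then have "(a @\<^sub>v b) \<^sub>v* (?T * ?L) = fld_of p 1 @\<^sub>v 0\<^sub>v ?n"
      using comp[OF TL] T L by simp
    then show ?thesis using mult[OF TL] by blast
  qed
  obtain a b where ab: "a \<in> carrier_vec ?n" "b \<in> carrier_vec ?n" "v = a @\<^sub>v b"
    using v hw_vector_cases[of v ?n] by (auto simp: hw_vertices_def)
  show ?thesis
  proof (cases "a = 0\<^sub>v ?n")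
    case False
    then show ?thesis using reach ab by blast
  next
    case True
    let ?Q = "inv_mat (W_mat p)"
    let ?g = "Omega ?n * L_mat ?Q"
    note W = inv_mat(1)[OF W_mat(1) det_W_mat[OF p]] det_inv_mat[OF W_mat(1) det_W_mat[OF p]]
    have g: "?g \<in> ?H" by (auto intro!: generate.incl simp: PK_gens_def PK_common_def)
    have v': "v \<in> carrier_vec (2 * ?n)" using v by (simp add: hw_vertices_def)
    have "inv_mat ?Q *\<^sub>v a = 0\<^sub>v ?n"
      using True inv_mat(1)[OF W] by (intro eq_vecI) auto
    \<comment> \<open>\<Omega> swaps the halves, and the other factor multiplies the new first half
      b by W^{-1}; the second half stays zero.\<close>
    then have vg: "v \<^sub>v* ?g = (b \<^sub>v* ?Q) @\<^sub>v 0\<^sub>v ?n"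
      using row_mult_Sp_mult[OF v' Omega_Sp L_mat_Sp[OF W]] row_mult_Omega[OF ab(1,2)]
        row_mult_L_mat[OF W ab(2,1)] ab(3) by simp
    \<comment> \<open>Otherwise a symplectic matrix would send the vertex \<open>v\<close> to the
      zero vector.\<close>
    have "b \<^sub>v* ?Q \<noteq> 0\<^sub>v ?n"
    proof
      assume "b \<^sub>v* ?Q = 0\<^sub>v ?n"
      then have "v \<^sub>v* ?g = 0\<^sub>v (2 * ?n)" using vg by (auto simp: mult_2 intro!: eq_vecI)
      then show False using hw_vertices_Sp[of ?g ?n v] g H_Sp v by (auto simp: hw_vertices_def)
    qed
    then obtain h where "h \<in> ?H" "((b \<^sub>v* ?Q) @\<^sub>v 0\<^sub>v ?n) \<^sub>v* h = fld_of p 1 @\<^sub>v 0\<^sub>v ?n"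
      using reach[of "b \<^sub>v* ?Q" "0\<^sub>v ?n"] row_mult_carrier[OF W(1)] by auto
    then show ?thesis using comp[OF g _ v'] mult[OF g] vg by metis
  qed
qed

text \<open>Allows any generating set between \<open>PK_gens p\<close> and \<open>Sp\<close>, so
  that both Kerdock groups are instances: enlarging the generators enlarges the group, which still
  takes every vertex to [1, 0].\<close>

lemma transitive_generated_vertices:
  assumes p: "irreducible p" and H: "PK_gens p \<subseteq> H" "H \<subseteq> carrier (Sp (degree p))"
  shows "transitive_right_action ((Sp (degree p))\<lparr>carrier := generate (Sp (degree p)) H\<rparr>)
    (hw_vertices (degree p)) row_mult"
proof (rule transitive_right_action_basepointI)
  interpret Sp: group "Sp (degree p)" by (rule group_Sp)
  have sub: "generate (Sp (degree p)) H \<subseteq> carrier (Sp (degree p))"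
    by (rule Sp.generate_incl[OF H(2)])
  show "group ((Sp (degree p))\<lparr>carrier := generate (Sp (degree p)) H\<rparr>)"
    by (rule Sp.subgroup_imp_group[OF Sp.generate_is_subgroup[OF H(2)]])
  fix v assume v: "v \<in> hw_vertices (degree p)"
  then show "v \<^sub>v* \<one>\<^bsub>(Sp (degree p))\<lparr>carrier := generate (Sp (degree p)) H\<rparr>\<^esub> = v"
    by (simp add: hw_vertices_def)
  show "\<exists>g\<in>carrier ((Sp (degree p))\<lparr>carrier := generate (Sp (degree p)) H\<rparr>).
      v \<^sub>v* g = fld_of p 1 @\<^sub>v 0\<^sub>v (degree p)"
    using PK_gens_reach_base[OF p v] Sp.mono_generate[OF H(1)] by auto
  fix g assume g: "g \<in> carrier ((Sp (degree p))\<lparr>carrier := generate (Sp (degree p)) H\<rparr>)"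
  then show "v \<^sub>v* g \<in> hw_vertices (degree p)" using hw_vertices_Sp[OF _ v] sub by auto
  fix h assume h: "h \<in> carrier ((Sp (degree p))\<lparr>carrier := generate (Sp (degree p)) H\<rparr>)"
  have "v \<^sub>v* (g * h) = v \<^sub>v* g \<^sub>v* h"
    by (rule row_mult_Sp_mult) (use v g h sub in \<open>auto simp: hw_vertices_def\<close>)
  then show "v \<^sub>v* (g \<otimes>\<^bsub>(Sp (degree p))\<lparr>carrier := generate (Sp (degree p)) H\<rparr>\<^esub> h) = v \<^sub>v* g \<^sub>v* h"
    by simp
qed

theorem lemma31:
  fixes m :: nat
  assumes "m \<ge> 1"
  shows "transitive_right_action (Sp m) (hw_vertices m) row_mult \<and>
         transitive_right_action (Sp m) (hw_edges m) row_mult_set \<and>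
         transitive_right_action (Sp m) (hw_nonedges m) row_mult_set \<and>
         (\<forall>p. primitive_poly p \<and> degree p = m \<longrightarrow>
            transitive_right_action (PK p) (hw_vertices m) row_mult \<and>
            transitive_right_action (PK_star p) (hw_vertices m) row_mult)"
proof (intro conjI allI impI)
  show "transitive_right_action (Sp m) (hw_vertices m) row_mult"
    by (rule transitive_Sp_vertices)
  show "transitive_right_action (Sp m) (hw_edges m) row_mult_set"
    "transitive_right_action (Sp m) (hw_nonedges m) row_mult_set"
    unfolding hw_edges_eq hw_nonedges_eq by (rule transitive_Sp_pairs)+
next
  fix p assume "primitive_poly p \<and> degree p = m"
  then have p: "irreducible p" and m: "m = degree p" by (auto simp: primitive_poly_def)
  note gens = PK_gens_subset_PK_star_gens[OF p] PK_star_gens_Sp[OF p]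
  show "transitive_right_action (PK p) (hw_vertices m) row_mult"
    unfolding PK_def m using gens by (intro transitive_generated_vertices[OF p]) auto
  show "transitive_right_action (PK_star p) (hw_vertices m) row_mult"
    unfolding PK_star_def m by (rule transitive_generated_vertices[OF p gens])
qed

end
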